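(* Let $r,s,t\in(0,1)$, set $m=sr+(1-r)t$, and let $\alpha,\beta\in[0,1]$. Let $f_1,f_2,f_3,f_4:(0,\infty)^d\to(0,\infty)$ be integrable functions such that \[ f_1(x)^m f_2(y)^{1-m}\le f_3\big(M_\alpha^s(x,y)\big)^r f_4\big(M_\beta^t(x,y)\big)^{1-r}\qquad\text{for all }x,y\in(0,\infty)^d . \] Then \[ \Big(\int_{(0,\infty)^d}f_1\Big)^m\Big(\int_{(0,\infty)^d}f_2\Big)^{1-m}\le\Big(\int_{(0,\infty)^d}f_3\Big)^r\Big(\int_{(0,\infty)^d}f_4\Big)^{1-r}. \]
   Context: For $x,y>0$, $\lambda\in[0,1]$ and $\alpha\in\mathbb{R}\setminus\{0\}$, $M_\alpha^\lambda(x,y)=(\lambda x^\alpha+(1-\lambda)y^\alpha)^{1/\alpha}$, and $M_0^\lambda(x,y)=x^\lambda y^{1-\lambda}$. For vectors $x,y\in(0,\infty)^d$, $M_\alpha^\lambda(x,y)$ is the vector with coordinates $M_\alpha^\lambda(x,y)_i=M_\alpha^\lambda(x_i,y_i)$. Integrals are with respect to Lebesgue measure. *)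

theory Defs
  imports "HOL-Analysis.Analysis"
begin

definition powmean :: "real \<Rightarrow> real \<Rightarrow> real \<Rightarrow> real \<Rightarrow> real" where
  "powmean a w x y =
     (if a = 0 then x powr w * y powr (1 - w)
      else (w * x powr a + (1 - w) * y powr a) powr (1 / a))"

definition vpowmean :: "real \<Rightarrow> real \<Rightarrow> real^'n \<Rightarrow> real^'n \<Rightarrow> real^'n" where
  "vpowmean a w x y = (\<chi> i. powmean a w (x $ i) (y $ i))"

definition pos_orthant :: "(real^'n) set" where
  "pos_orthant = {x. \<forall>i. 0 < x $ i}"

end

theory Submission
  imports Defs
begin

text \<open>
  In dimension one this is a transport argument. Let $X, Y$ be the quantile functions of the
  normalised $f_1, f_2$ on $[0,1]$, so that $f_1(X)\,X' = \int f_1$ and $f_2(Y)\,Y' = \int f_2$. The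
  curve $A = M_\alpha^s(X, Y)$ satisfies $A' \ge X'^s\,Y'^{1-s}$, by the weighted AM-GM inequality
  together with $M_\alpha^s \ge M_0^s$ (here $\alpha \le 1$ enters), hence
  $\int f_3 \ge \int_0^1 f_3(A)\,X'^s\,Y'^{1-s}$, and likewise for $f_4$ along $M_\beta^t(X, Y)$.
  By hypothesis the geometric mean of the two right-hand integrands with weights $r, 1-r$ is at
  least the constant $(\int f_1)^m (\int f_2)^{1-m}$, and AM-GM (in place of Hoelder, after
  normalising $f_3, f_4$) gives the claim. Higher dimensions follow by
  integrating out one coordinate at a time, since the marginals inherit the hypothesis. All this is
  carried out on a box $[1/K, K]^d$ for Borel functions bounded away from $0$ and $\infty$; the
  general case is a limit of truncations.
\<close>

section \<open>Integrals along expanding curves\<close>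

text \<open>Two obstacles shape the details. They are replaced by the bounded functions \<xi> = F1 /
  f1(X) and \<eta> = F2 / f2(Y), where F1 and F2 are the integrals of f1 and f2, and these are used
  only under the integral sign: \<xi> and \<eta> integrate to the increments of X and Y, and w =
  \<xi>^s \<eta>^(1-s) integrates to at most the increments of A. Such a bound says that A pushes w
  du to a measure below Lebesgue measure, which is all the change of variables that is needed. The
  second obstacle is that the hypothesis ties together values at four points, x, y and their two
  means, so altering a function on a null set can destroy it. Hence the exceptional null set of the
  Borel representatives is carried along explicitly, and the truncations take values on it for which
  the inequality is automatic: a tiny constant for f1 and f2, a huge one for f3 and f4.\<close>

lemma emeasure_le_lborel:
  fixes \<mu> :: "real measure"
  assumes sets: "sets \<mu> = sets borel"
    and le: "\<And>p q. p \<le> q \<Longrightarrow> emeasure \<mu> {p..q} \<le> ennreal (q - p)"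
    and B: "B \<in> sets borel"
  shows "emeasure \<mu> B \<le> emeasure lborel B"
proof -
  note [measurable_cong, simp] = sets
  \<comment> \<open>The comparison spreads from closed intervals to bounded connected sets (adding
    endpoints costs no length), to all connected sets by exhaustion, to open sets through their
    countably many components, and to \<open>B\<close> by outer regularity of Lebesgue
    measure.\<close>
  have bounded_case: "emeasure \<mu> D \<le> emeasure lborel D"
    if D: "connected D" "bounded D" "D \<in> sets borel" for D :: "real set"
  proof (cases "D = {}")
    case False
    have bd: "bdd_below D" "bdd_above D"
      using D(2) by (auto simp: bounded_imp_bdd_below bounded_imp_bdd_above)
    have IS: "Inf D \<le> Sup D"
      using cInf_le_cSup[OF False] bd by auto
    have sub: "D \<subseteq> {Inf D..Sup D}"
      using bd by (auto intro: cInf_lower cSup_upper)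
    have sub': "{Inf D<..<Sup D} \<subseteq> D"
    proof
      fix x assume "x \<in> {Inf D<..<Sup D}"
      then obtain y z where "y \<in> D" "y < x" "z \<in> D" "x < z"
        using cInf_lessD[OF False] less_cSupD[OF False] by (metis greaterThanLessThan_iff)
      then show "x \<in> D"
        using D(1) by (meson connected_iff_interval less_imp_le)
    qed
    have "emeasure \<mu> D \<le> emeasure \<mu> {Inf D..Sup D}"
      using sub by (intro emeasure_mono) auto
    also have "\<dots> \<le> emeasure lborel {Inf D<..<Sup D}"
      using le[OF IS] IS by simp
    also have "\<dots> \<le> emeasure lborel D"
      using sub' D(3) by (intro emeasure_mono) auto
    finally show ?thesis .
  qed simp
  have interval_case: "emeasure \<mu> D \<le> emeasure lborel D"
    if D: "connected D" "D \<in> sets borel" for D :: "real set"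
  proof -
    define E where "E n = D \<inter> {- real n..real n}" for n
    have E: "range E \<subseteq> sets borel" "incseq E"
      using D by (auto simp: E_def incseq_def)
    have "(\<Union>n. E n) = D"
    proof -
      have "\<exists>n. x \<in> {- real n..real n}" for x
        using real_arch_simple[of "\<bar>x\<bar>"] by (force simp: abs_le_iff)
      then show ?thesis by (auto simp: E_def)
    qed
    then have "emeasure \<mu> D = (SUP n. emeasure \<mu> (E n))" "emeasure lborel D = (SUP n. emeasure lborel (E n))"
      using SUP_emeasure_incseq[of E \<mu>] SUP_emeasure_incseq[of E lborel] E by auto
    moreover have "emeasure \<mu> (E n) \<le> emeasure lborel (E n)" for n
    proof (rule bounded_case)
      show "connected (E n)"
        using D(1) by (auto simp: E_def connected_iff_interval)
      show "bounded (E n)"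
        unfolding E_def by (rule bounded_subset[OF bounded_closed_interval]) auto
    qed (use E in auto)
    ultimately show ?thesis
      by (auto intro!: SUP_mono)
  qed
  have open_case: "emeasure \<mu> U \<le> emeasure lborel U" if U: "open U" for U
  proof -
    let ?C = "components U"
    have op: "open D" if "D \<in> ?C" for D
      using open_components[OF U that] .
    have disj: "disjoint_family_on (\<lambda>D. D) ?C"
      using pairwise_disjoint_components[of U] by (auto simp: disjoint_family_on_def pairwise_def)
    have cnt: "countable ?C"
      using op pairwise_disjoint_components[of U]
      by (intro countable_disjoint_open_subsets) (auto simp: disjnt_def pairwise_def)
    have "emeasure \<mu> U = (\<integral>\<^sup>+D. emeasure \<mu> D \<partial>count_space ?C)"
      using emeasure_UN_countable[of ?C "\<lambda>D. D" \<mu>] disj cnt op by auto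
    also have "\<dots> \<le> (\<integral>\<^sup>+D. emeasure lborel D \<partial>count_space ?C)"
      using op by (intro nn_integral_mono interval_case) (auto simp: in_components_connected)
    also have "\<dots> = emeasure lborel U"
      using emeasure_UN_countable[of ?C "\<lambda>D. D" lborel] disj cnt op by auto
    finally show ?thesis .
  qed
  show ?thesis
  proof (rule ennreal_le_epsilon)
    fix e :: real assume "0 < e"
    obtain U where U: "open U" "B \<subseteq> U" "emeasure lborel (U - B) < e"
      using outer_regular_lborel[OF B \<open>0 < e\<close>] .
    have "emeasure \<mu> B \<le> emeasure \<mu> U"
      using U by (intro emeasure_mono) auto
    also have "\<dots> \<le> emeasure lborel U"
      by (rule open_case[OF U(1)])
    also have "\<dots> = emeasure lborel B + emeasure lborel (U - B)"
      using U B by (subst plus_emeasure) (auto intro: arg_cong[where f="emeasure lborel"])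
    also have "\<dots> \<le> emeasure lborel B + e"
      using U by (intro add_left_mono) auto
    finally show "emeasure \<mu> B \<le> emeasure lborel B + e" .
  qed
qed

section \<open>Bounded Borel functions on compact intervals\<close>

lemma set_integrable_bounded_Icc:
  fixes f :: "real \<Rightarrow> real"
  assumes [measurable]: "f \<in> borel_measurable borel" and "\<And>x. 0 \<le> f x" "\<And>x. f x \<le> C"
  shows "set_integrable lborel {p..q} f"
proof (rule set_integrable_bound[of _ _ "\<lambda>_. C"])
  show "set_integrable lborel {p..q} (\<lambda>_. C)"
    by (cases "p \<le> q") (auto simp: set_integrable_def)
  show "AE x in lborel. x \<in> {p..q} \<longrightarrow> norm (f x) \<le> norm C"
    using assms(2,3) by (intro AE_I2) (auto intro: order_trans[OF _ abs_ge_self])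
qed (simp add: set_borel_measurable_def)

lemma nn_integral_bounded_Icc:
  fixes f :: "real \<Rightarrow> real"
  assumes [measurable]: "f \<in> borel_measurable borel" and "\<And>x. 0 \<le> f x" "\<And>x. f x \<le> C"
  shows "(\<integral>\<^sup>+x. ennreal (f x) * indicator {p..q} x \<partial>lborel) = ennreal (LBINT x:{p..q}. f x)"
proof -
  have "(\<integral>\<^sup>+x. ennreal (f x) * indicator {p..q} x \<partial>lborel)
      = (\<integral>\<^sup>+x. ennreal (indicator {p..q} x *\<^sub>R f x) \<partial>lborel)"
    by (intro nn_integral_cong) (auto simp: indicator_def)
  also have "\<dots> = ennreal (LBINT x:{p..q}. f x)"
    using set_integrable_bounded_Icc[OF assms, of p q] assms(2)
    unfolding set_integrable_def set_lebesgue_integral_def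
    by (intro nn_integral_eq_integral) auto
  finally show ?thesis .
qed

lemma set_integral_nonneg_Icc:
  fixes f :: "real \<Rightarrow> real"
  assumes "\<And>x. 0 \<le> f x"
  shows "0 \<le> (LBINT x:{p..q}. f x)"
  unfolding set_lebesgue_integral_def using assms by (intro integral_nonneg_AE) auto

lemma set_integral_Icc_combine:
  fixes f :: "real \<Rightarrow> real"
  assumes "f \<in> borel_measurable borel" "\<And>x. 0 \<le> f x" "\<And>x. f x \<le> C" "p \<le> q" "q \<le> r"
  shows "(LBINT x:{p..q}. f x) + (LBINT x:{q..r}. f x) = (LBINT x:{p..r}. f x)"
proof -
  have "interval_lebesgue_integrable lborel p r f"
    using assms set_integrable_subset[OF set_integrable_bounded_Icc[OF assms(1-3), of p r], of "{p<..<r}"]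
      greaterThanLessThan_subseteq_atLeastAtMost_iff[of p r p r]
    by (simp add: interval_lebesgue_integrable_def)
  then have "(LBINT x=p..q. f x) + (LBINT x=q..r. f x) = (LBINT x=p..r. f x)"
    using assms by (intro interval_integral_sum) (auto simp: min_def max_def)
  then show ?thesis
    using assms by (simp add: interval_integral_Icc)
qed

lemma set_integrable_Icc_const: "set_integrable lborel {p..q} (\<lambda>_. d)" for p q d :: real
  by (cases "p \<le> q") (auto simp: set_integrable_def)

lemma set_integral_Icc_const: "p \<le> q \<Longrightarrow> (LBINT x:{p..q}. d) = d * (q - p)" for p q d :: real
  by (subst set_integral_const) auto

lemma lipschitz_on_mono_increment:
  fixes Z :: "real \<Rightarrow> real"
  assumes "mono Z" "\<And>u v. u \<le> v \<Longrightarrow> Z v - Z u \<le> K * (v - u)" "0 \<le> K"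
  shows "K-lipschitz_on UNIV Z"
proof (rule lipschitz_onI)
  fix u v :: real
  show "dist (Z u) (Z v) \<le> K * dist u v"
    using assms(2)[of u v] assms(2)[of v u] monoD[OF assms(1), of u v] monoD[OF assms(1), of v u]
    by (cases "u \<le> v") (auto simp: dist_real_def abs_if)
qed (fact assms(3))

text \<open>A change of variables without derivatives. The parameters that \<open>A\<close> sends
  into [p, q] lie between a smallest one i and a largest one j, and the \<open>w\<close>-mass of
  [i, j] is at most A j - A i \<le> q - p. So the image of \<open>w\<close> du under
  \<open>A\<close> is dominated by Lebesgue measure on intervals, hence on Borel sets, and
  \<open>f\<close> is integrated against both.\<close>

lemma integral_ge_along_expanding_map:
  fixes A w f :: "real \<Rightarrow> real"
  assumes A: "continuous_on {0..1} A" "\<And>u. u \<in> {0..1} \<Longrightarrow> A u \<in> {a..b}"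
    and w[measurable]: "w \<in> borel_measurable borel" and w0: "\<And>u. 0 \<le> w u" and wK: "\<And>u. w u \<le> K"
    and f[measurable]: "f \<in> borel_measurable borel" and f0: "\<And>x. 0 \<le> f x" and fC: "\<And>x. f x \<le> C"
    and incr: "\<And>p q. 0 \<le> p \<Longrightarrow> p \<le> q \<Longrightarrow> q \<le> 1 \<Longrightarrow> (LBINT u:{p..q}. w u) \<le> A q - A p"
  shows "set_integrable lborel {0..1} (\<lambda>u. f (A u) * w u)" (is ?integrable)
    and "(LBINT u:{0..1}. f (A u) * w u) \<le> (LBINT x:{a..b}. f x)" (is ?le)
proof -
  \<comment> \<open>Clamping the argument to [0, 1] makes the curve continuous, hence Borel, on the
    whole line.\<close>
  define A' where "A' u = A (max 0 (min 1 u))" for u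
  have A'A: "A' u = A u" if "u \<in> {0..1}" for u
    using that by (auto simp: A'_def)
  have "continuous_on UNIV A'"
    unfolding A'_def
    by (rule continuous_on_compose2[OF A(1)]) (auto intro!: continuous_intros)
  then have [measurable]: "A' \<in> borel_measurable borel"
    by (rule borel_measurable_continuous_onI)
  define \<nu> where "\<nu> = density lborel (\<lambda>u. ennreal (w u) * indicator {0..1} u)"
  have [simp, measurable_cong]: "sets \<nu> = sets borel" by (simp add: \<nu>_def)
  define \<mu> where "\<mu> = distr \<nu> borel A'"
  have sets_\<mu>: "sets \<mu> = sets borel" by (simp add: \<mu>_def)
  have "emeasure \<mu> {p..q} \<le> ennreal (q - p)" if pq: "p \<le> q" for p q
  proof -
    define S where "S = {0..1} \<inter> A -` {p..q}"
    have [measurable]: "A' -` {p..q} \<in> sets borel"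
      by (rule measurable_sets_borel[of A' borel]) auto
    have em: "emeasure \<mu> {p..q} = (\<integral>\<^sup>+u. ennreal (w u) * indicator {0..1} u * indicator (A' -` {p..q}) u \<partial>lborel)"
      unfolding \<mu>_def
      by (subst emeasure_distr)
         (auto simp: \<nu>_def emeasure_density)
    show ?thesis
    proof (cases "S = {}")
      case True
      then have "ennreal (w u) * indicator {0..1} u * indicator (A' -` {p..q}) u = 0" for u
        using A'A by (auto simp: S_def indicator_def)
      then show ?thesis unfolding em by (simp only: nn_integral_const mult_zero_left zero_le)
    next
      case False
      have "closed S"
        unfolding S_def using A(1) by (intro continuous_closed_preimage) auto
      have bd: "bdd_below S" "bdd_above S"
        by (auto simp: S_def)
      define i j where "i = Inf S" and "j = Sup S"
      have ij: "i \<in> S" "j \<in> S"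
        unfolding i_def j_def
        using closed_contains_Inf[OF False bd(1) \<open>closed S\<close>] closed_contains_Sup[OF False bd(2) \<open>closed S\<close>] by auto
      have Sij: "S \<subseteq> {i..j}"
        using bd by (auto simp: i_def j_def intro: cInf_lower cSup_upper)
      have "emeasure \<mu> {p..q} \<le> (\<integral>\<^sup>+u. ennreal (w u) * indicator {i..j} u \<partial>lborel)"
        unfolding em
        by (intro nn_integral_mono) (use Sij A'A in \<open>auto simp: indicator_def S_def\<close>)
      also have "\<dots> = ennreal (LBINT u:{i..j}. w u)"
        by (rule nn_integral_bounded_Icc[OF w w0 wK])
      also have "\<dots> \<le> ennreal (q - p)"
        using incr[of i j] ij Sij by (intro ennreal_leI) (auto simp: S_def)
      finally show ?thesis .
    qed
  qed
  then have "\<mu> \<le> lborel"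
    using emeasure_le_lborel[OF sets_\<mu>] sets_\<mu>
    by (auto simp: le_measure_iff le_fun_def \<mu>_def intro: emeasure_notin_sets)
       (metis emeasure_notin_sets sets_\<mu> \<mu>_def zero_le)
  then have le: "integral\<^sup>N \<mu> g \<le> integral\<^sup>N lborel g" for g
    by (rule nn_integral_mono_measure[rotated]) (simp add: sets_\<mu>)
  define g where "g u = (if u \<in> {0..1} then f (A' u) * w u else 0)" for u
  have [measurable]: "g \<in> borel_measurable borel" unfolding g_def by measurable
  have g0: "0 \<le> g u" for u using f0 w0 by (simp add: g_def)
  have C0: "0 \<le> C" using order_trans[OF f0 fC] .
  have gC: "g u \<le> C * K" for u
    using f0 fC w0 wK order_trans[OF w0 wK] C0 by (auto simp: g_def intro!: mult_mono)
  have "set_integrable lborel {0..1} g"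
    by (rule set_integrable_bounded_Icc[OF _ g0 gC]) simp
  then show ?integrable
    by (rule set_integrable_cong[THEN iffD1, rotated 3]) (auto simp: g_def A'A)
  have "ennreal (LBINT u:{0..1}. f (A u) * w u) = ennreal (LBINT u:{0..1}. g u)"
    by (intro arg_cong[where f=ennreal] set_lebesgue_integral_cong) (auto simp: g_def A'A)
  also have "\<dots> = (\<integral>\<^sup>+u. ennreal (g u) * indicator {0..1} u \<partial>lborel)"
    by (rule nn_integral_bounded_Icc[OF _ g0 gC, symmetric]) simp
  also have "\<dots> = (\<integral>\<^sup>+u. ennreal (w u) * indicator {0..1} u * (ennreal (f (A' u)) * indicator {a..b} (A' u)) \<partial>lborel)"
    using A(2) A'A f0 w0
    by (intro nn_integral_cong) (auto simp: g_def indicator_def ennreal_mult mult_ac)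
  also have "\<dots> = (\<integral>\<^sup>+x. ennreal (f x) * indicator {a..b} x \<partial>\<mu>)"
    unfolding \<mu>_def
    by (subst nn_integral_distr) (auto simp: \<nu>_def nn_integral_density)
  also have "\<dots> \<le> (\<integral>\<^sup>+x. ennreal (f x) * indicator {a..b} x \<partial>lborel)"
    by (rule le)
  also have "\<dots> = ennreal (LBINT x:{a..b}. f x)"
    by (rule nn_integral_bounded_Icc[OF f f0 fC])
  finally show ?le
    using set_integral_nonneg_Icc[of f, OF f0] by (simp add: ennreal_le_iff)
qed

text \<open>\<open>X\<close> is the inverse of the normalised primitive of \<open>f\<close>. The
  last property is X' = F / f(X) in integrated form. Since \<open>f\<close> is bounded below by
  \<open>c\<close> on the whole line, the primitive is a bijection of the line and \<open>X\<close>
  is defined everywhere.\<close>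

lemma quantile_exists:
  fixes f :: "real \<Rightarrow> real"
  assumes f[measurable]: "f \<in> borel_measurable borel" and c: "0 < c"
    and fc: "\<And>x. c \<le> f x" and fC: "\<And>x. f x \<le> C" and ab: "a < b"
  defines "F \<equiv> (LBINT x:{a..b}. f x)"
  obtains X :: "real \<Rightarrow> real" where "X 0 = a" "X 1 = b" "mono X"
    "\<And>u v. u \<le> v \<Longrightarrow> (LBINT w:{u..v}. F / f (X w)) = X v - X u"
proof -
  have f0: "0 \<le> f x" for x using c fc[of x] by linarith
  have int: "set_integrable lborel {p..q} f" for p q
    by (rule set_integrable_bounded_Icc[OF f f0 fC])
  define G where "G x = (LBINT t=a..x. f t)" for x :: real
  have G: "G q - G p = (LBINT x:{p..q}. f x)" if "p \<le> q" for p q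
  proof -
    have "interval_lebesgue_integrable lborel (min (ereal a) (min (ereal p) (ereal q)))
        (max (ereal a) (max (ereal p) (ereal q))) f"
      using set_integrable_subset[OF int _ greaterThanLessThan_subseteq_atLeastAtMost_iff[THEN iffD2, OF impI]]
      by (auto simp: interval_lebesgue_integrable_def min_def max_def)
    then have "G p + (LBINT x=p..q. f x) = G q"
      unfolding G_def by (rule interval_integral_sum)
    then show ?thesis using interval_integral_Icc[OF that, of f] by simp
  qed
  note const = set_integral_Icc_const
  have Glo: "c * (q - p) \<le> G q - G p" if "p \<le> q" for p q
    unfolding G[OF that] const[OF that, symmetric]
    by (rule set_integral_mono[OF set_integrable_Icc_const int]) (use fc in auto)
  have Gup: "G q - G p \<le> C * (q - p)" if "p \<le> q" for p q
    unfolding G[OF that] const[OF that, symmetric]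
    by (rule set_integral_mono[OF int set_integrable_Icc_const]) (use fC in auto)
  have Ga: "G a = 0" and Gb: "G b = F"
    using G[of a b] ab by (auto simp: F_def G_def)
  have F: "0 < F" using Glo[of a b] ab c Ga Gb by (smt (verit) mult_pos_pos)
  define \<Phi> where "\<Phi> x = G x / F" for x
  have \<Phi>: "\<Phi> q - \<Phi> p = (LBINT x:{p..q}. f x / F)" if "p \<le> q" for p q
    using G[OF that] by (simp add: \<Phi>_def diff_divide_distrib[symmetric])
  have smono: "strict_mono \<Phi>"
  proof (rule strict_monoI)
    fix p q :: real assume "p < q"
    then show "\<Phi> p < \<Phi> q"
      using Glo[of p q] F mult_pos_pos[OF c, of "q - p"]
      unfolding \<Phi>_def by (intro divide_strict_right_mono) linarith+
  qed
  have "(C)-lipschitz_on UNIV G"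
  proof (rule lipschitz_on_mono_increment[OF _ Gup])
    show "0 \<le> C" using order_trans[OF f0 fC] .
    show "mono G"
      using G set_integral_nonneg_Icc[of f, OF f0] by (intro monoI) (simp add: algebra_simps)
  qed
  then have contG: "continuous_on UNIV G" by (rule lipschitz_on_continuous_on)
  then have cont: "continuous_on UNIV \<Phi>"
    unfolding \<Phi>_def using F by (intro continuous_intros) auto
  have [measurable]: "\<Phi> \<in> borel_measurable borel"
    using cont by (rule borel_measurable_continuous_onI)
  have surj: "surj \<Phi>"
  proof -
    have "\<exists>x. \<Phi> x = y" for y
    proof -
      \<comment> \<open>\<open>G\<close> vanishes at \<open>a\<close> and grows at rate at least
        \<open>c\<close>, so within distance \<open>d\<close> of \<open>a\<close> it passes the
        level \<open>y * F\<close>.\<close>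
      define d where "d = \<bar>y * F\<bar> / c"
      have d: "0 \<le> d" "c * d = \<bar>y * F\<bar>" using c by (auto simp: d_def)
      have "G (a + d) \<ge> c * d" "G (a - d) \<le> - (c * d)"
        using Glo[of a "a + d"] Glo[of "a - d" a] d Ga by auto
      then have "G (a - d) \<le> y * F" "y * F \<le> G (a + d)" using d by linarith+
      then obtain x where "G x = y * F"
        using IVT'[of G "a - d" "y * F" "a + d"] d continuous_on_subset[OF contG] by auto
      then show ?thesis using F by (intro exI[of _ x]) (simp add: \<Phi>_def)
    qed
    then show ?thesis by (metis surjI)
  qed
  have inj: "inj \<Phi>" using smono by (rule strict_mono_imp_inj_on)
  define X where "X = inv \<Phi>"
  have X\<Phi>: "X (\<Phi> x) = x" for x using inj by (simp add: X_def)
  have \<Phi>X: "\<Phi> (X u) = u" for u using surj by (simp add: X_def surj_f_inv_f)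
  have Xle: "\<Phi> x \<le> u \<longleftrightarrow> x \<le> X u" "u \<le> \<Phi> x \<longleftrightarrow> X u \<le> x"
       "\<Phi> x < u \<longleftrightarrow> x < X u" "u < \<Phi> x \<longleftrightarrow> X u < x" for x u
    using strict_mono_less_eq[OF smono, of x "X u"] strict_mono_less_eq[OF smono, of "X u" x]
      strict_mono_less[OF smono, of x "X u"] strict_mono_less[OF smono, of "X u" x] by (auto simp: \<Phi>X)
  have monoX: "mono X"
    by (rule monoI) (metis Xle(1) \<Phi>X)
  then have [measurable]: "X \<in> borel_measurable borel" by (rule borel_measurable_mono)
  have dF0: "0 \<le> f x / F" for x using f0 F by simp
  have dFC: "f x / F \<le> C / F" for x using fC F by (simp add: divide_right_mono)
  \<comment> \<open>Lebesgue measure is the image under \<Phi> of the measure with density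
    \<open>f / F\<close>. Substituting w = \<Phi> x in the integral of \<open>F / f (X w)\<close>
    then cancels the density and leaves the length of [X u, X v].\<close>
  have push: "lborel = distr (density lborel (\<lambda>x. ennreal (f x / F))) borel \<Phi>"
  proof (rule lborel_eqI)
    fix l u :: real assume "\<And>b. b \<in> Basis \<Longrightarrow> l \<bullet> b \<le> u \<bullet> b"
    then have lu: "l \<le> u" by simp
    have "emeasure (distr (density lborel (\<lambda>x. ennreal (f x / F))) borel \<Phi>) (box l u)
        = (\<integral>\<^sup>+x. ennreal (f x / F) * indicator (box l u) (\<Phi> x) \<partial>lborel)"
      by (subst nn_integral_indicator[symmetric]) (auto simp: nn_integral_distr nn_integral_density simp del: nn_integral_indicator)
    also have "\<dots> = (\<integral>\<^sup>+x. ennreal (f x / F) * indicator {X l..X u} x \<partial>lborel)"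
    proof (rule nn_integral_cong_AE)
      have "AE x in lborel. x \<noteq> X l \<and> x \<noteq> X u"
        using AE_lborel_singleton[of "X l"] AE_lborel_singleton[of "X u"] by eventually_elim auto
      then show "AE x in lborel. ennreal (f x / F) * indicator (box l u) (\<Phi> x)
           = ennreal (f x / F) * indicator {X l..X u} x"
        by eventually_elim (auto simp: indicator_def box_real Xle)
    qed
    also have "\<dots> = ennreal (u - l)"
      using \<Phi>[of "X l" "X u"] monoX[THEN monoD, OF lu]
      by (subst nn_integral_bounded_Icc[OF _ dF0 dFC]) (auto simp: \<Phi>X)
    finally show "emeasure (distr (density lborel (\<lambda>x. ennreal (f x / F))) borel \<Phi>) (box l u)
        = (\<Prod>b\<in>Basis. (u - l) \<bullet> b)" using lu by simp
  qed simp
  have incr: "(LBINT w:{u..v}. F / f (X w)) = X v - X u" if "u \<le> v" for u v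
  proof -
    have "(LBINT w:{u..v}. F / f (X w))
        = (LINT w|distr (density lborel (\<lambda>x. ennreal (f x / F))) borel \<Phi>. indicator {u..v} w * (F / f (X w)))"
      using push by (simp add: set_lebesgue_integral_def)
    also have "\<dots> = (LBINT x. f x / F * (indicator {u..v} (\<Phi> x) * (F / f x)))"
      using dF0 by (subst integral_distr) (auto simp: integral_density X\<Phi>)
    also have "\<dots> = (LBINT x:{X u..X v}. 1)"
    proof -
      have "f x / F * (indicator {u..v} (\<Phi> x) * (F / f x)) = indicator {X u..X v} x" for x
        using F order.strict_trans2[OF c fc, of x] by (simp add: indicator_def Xle)
      then show ?thesis by (simp add: set_lebesgue_integral_def)
    qed
    also have "\<dots> = X v - X u"
      using const[of "X u" "X v" 1] monoX[THEN monoD, OF that] by simp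
    finally show ?thesis .
  qed
  have "X 0 = a" "X 1 = b"
    using X\<Phi>[of a] X\<Phi>[of b] Ga Gb F by (auto simp: \<Phi>_def)
  then show thesis using monoX incr by (rule that)
qed

section \<open>The inequality on an interval\<close>

text \<open>
  The last condition says that along any curve \<open>(x, y)\<close> with positive velocities \<open>(\<xi>, \<eta>)\<close>, the
  speed of \<open>M x y\<close> is at least \<open>\<xi>\<^sup>s \<eta>\<^sup>1\<^sup>-\<^sup>s\<close>.
\<close>

definition geo_expanding :: "real \<Rightarrow> real \<Rightarrow> real \<Rightarrow> (real \<Rightarrow> real \<Rightarrow> real) \<Rightarrow> bool" where
  "geo_expanding a b s M \<longleftrightarrow> (\<forall>x\<in>{a..b}. \<forall>y\<in>{a..b}. M x y \<in> {a..b} \<and>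
     (\<exists>P Q. ((\<lambda>z. M (fst z) (snd z)) has_derivative (\<lambda>h. P * fst h + Q * snd h)) (at (x, y)) \<and>
            (\<forall>\<xi>>0. \<forall>\<eta>>0. \<xi> powr s * \<eta> powr (1 - s) \<le> P * \<xi> + Q * \<eta>)))"

lemma powr_weighted_le:
  fixes x y :: real
  assumes "0 < x" "x \<le> K" "0 < y" "y \<le> K" "0 \<le> s" "s \<le> 1"
  shows "x powr s * y powr (1 - s) \<le> K"
proof -
  have "x powr s * y powr (1 - s) \<le> s * x + (1 - s) * y"
    using assms by (intro Youngs_inequality_0) auto
  also have "\<dots> \<le> s * K + (1 - s) * K"
    using assms by (intro add_mono mult_left_mono) auto
  finally show ?thesis by (simp add: algebra_simps)
qed

text \<open>The integrated form of A' \<ge> \<xi>^s \<eta>^(1-s) for A = M(X, Y). The lower bound P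
  \<xi> + Q \<eta> is linear in the densities, so with \<open>P\<close> and \<open>Q\<close> frozen
  at one point it integrates to P and Q times the increments of X and Y, which approximate the
  increment of A.\<close>

lemma geo_expanding_increment:
  fixes X Y \<xi> \<eta> :: "real \<Rightarrow> real"
  assumes M: "geo_expanding a b s M" and s: "0 < s" "s < 1"
    and [measurable]: "\<xi> \<in> borel_measurable borel" "\<eta> \<in> borel_measurable borel"
    and \<xi>: "\<And>u. 0 < \<xi> u" "\<And>u. \<xi> u \<le> K" and \<eta>: "\<And>u. 0 < \<eta> u" "\<And>u. \<eta> u \<le> K"
    and X: "\<And>u v. u \<le> v \<Longrightarrow> (LBINT w:{u..v}. \<xi> w) = X v - X u"
    and Y: "\<And>u v. u \<le> v \<Longrightarrow> (LBINT w:{u..v}. \<eta> w) = Y v - Y u"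
    and range: "\<And>u. u \<in> {0..1} \<Longrightarrow> X u \<in> {a..b}" "\<And>u. u \<in> {0..1} \<Longrightarrow> Y u \<in> {a..b}"
    and pq: "0 \<le> p" "p \<le> q" "q \<le> 1"
  shows "(LBINT u:{p..q}. \<xi> u powr s * \<eta> u powr (1 - s)) \<le> M (X q) (Y q) - M (X p) (Y p)"
proof -
  define w where "w u = \<xi> u powr s * \<eta> u powr (1 - s)" for u
  define A where "A u = M (X u) (Y u)" for u
  have [measurable]: "w \<in> borel_measurable borel" unfolding w_def by measurable
  have w0: "0 \<le> w u" for u by (simp add: w_def)
  have wK: "w u \<le> K" for u unfolding w_def using \<xi> \<eta> s by (intro powr_weighted_le) auto
  have K: "0 < K" using \<xi>[of 0] by linarith
  have \<xi>0: "0 \<le> \<xi> u" and \<eta>0: "0 \<le> \<eta> u" for u using \<xi>(1)[of u] \<eta>(1)[of u] by auto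
  have int\<xi>: "set_integrable lborel {u..v} \<xi>" and int\<eta>: "set_integrable lborel {u..v} \<eta>"
    and intw: "set_integrable lborel {u..v} w" for u v
    using set_integrable_bounded_Icc[OF _ \<xi>0 \<xi>(2)] set_integrable_bounded_Icc[OF _ \<eta>0 \<eta>(2)]
      set_integrable_bounded_Icc[OF _ w0 wK] by auto
  have lip: "0 \<le> X v - X u" "X v - X u \<le> K * (v - u)" "0 \<le> Y v - Y u" "Y v - Y u \<le> K * (v - u)"
    if "u \<le> v" for u v
    using set_integral_nonneg_Icc[of \<xi> u v, OF \<xi>0] set_integral_nonneg_Icc[of \<eta> u v, OF \<eta>0]
      set_integral_mono[OF int\<xi>[of u v] set_integrable_Icc_const[of u v K] \<xi>(2)]
      set_integral_mono[OF int\<eta>[of u v] set_integrable_Icc_const[of u v K] \<eta>(2)]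
    by (simp_all add: X[OF that] Y[OF that] set_integral_Icc_const[OF that])
  \<comment> \<open>\<open>X\<close> and \<open>Y\<close> need not be differentiable anywhere. Linearising \<open>M\<close> at one point, the local
    increments of \<open>A\<close> are bounded by integrals of \<open>P \<xi> + Q \<eta>\<close>, and bisection makes this global.\<close>
  have main: "(LBINT u:{p..q}. w u) \<le> A q - A p + e" if "0 < e" for e
  proof -
    \<comment> \<open>An error proportional to \<open>q - p\<close> adds up over adjacent intervals,
      as the bisection rule \<open>Bolzano\<close> requires.\<close>
    have "0 \<le> p \<and> q \<le> 1 \<longrightarrow> (LBINT u:{p..q}. w u) \<le> A q - A p + e * (q - p)"
      using pq(2)
    proof (induction rule: Bolzano)
      case (trans p q r)
      then show ?case
        using set_integral_Icc_combine[of w K p q r] w0 wK by (auto simp: algebra_simps)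
    next
      case (local x)
      then have x: "x \<in> {0..1}" using pq by auto
      from range[OF x] M obtain P Q where
        der: "((\<lambda>z. M (fst z) (snd z)) has_derivative (\<lambda>h. P * fst h + Q * snd h)) (at (X x, Y x))"
        and PQ: "\<And>\<xi> \<eta>. 0 < \<xi> \<Longrightarrow> 0 < \<eta> \<Longrightarrow> \<xi> powr s * \<eta> powr (1 - s) \<le> P * \<xi> + Q * \<eta>"
        unfolding geo_expanding_def by blast
      \<comment> \<open>Both curves are \<open>K\<close>-Lipschitz, so (X, Y) moves by at most 2 K
        |v - x| and the linearisation error is at most e |v - x|. For p \<le> x \<le> q the errors
        at both ends sum to e (q - p).\<close>
      have e': "0 < e / (2 * K)" using that K by simp
      from der[unfolded has_derivative_at_alt] e' obtain d where d: "0 < d"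
        and dP: "\<And>z. norm (z - (X x, Y x)) < d \<Longrightarrow>
           norm (M (fst z) (snd z) - M (X x) (Y x) - (P * fst (z - (X x, Y x)) + Q * snd (z - (X x, Y x))))
             \<le> e / (2 * K) * norm (z - (X x, Y x))"
        unfolding fst_conv snd_conv by blast
      have near: "\<bar>A v - A x - (P * (X v - X x) + Q * (Y v - Y x))\<bar> \<le> e * \<bar>v - x\<bar>"
        if v: "\<bar>v - x\<bar> < d / (2 * K)" for v
      proof -
        have "\<bar>X v - X x\<bar> \<le> K * \<bar>v - x\<bar>" "\<bar>Y v - Y x\<bar> \<le> K * \<bar>v - x\<bar>"
          using lip[of v x] lip[of x v] by (cases "v \<le> x"; simp add: abs_if)+
        then have n: "norm ((X v, Y v) - (X x, Y x)) \<le> 2 * K * \<bar>v - x\<bar>"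
          using norm_Pair_le[of "X v - X x" "Y v - Y x"] by simp
        also have "\<dots> < d" using v K by (simp add: field_simps)
        finally have "norm (A v - A x - (P * (X v - X x) + Q * (Y v - Y x)))
            \<le> e / (2 * K) * norm ((X v, Y v) - (X x, Y x))"
          using dP[of "(X v, Y v)"] by (simp add: A_def)
        also have "\<dots> \<le> e / (2 * K) * (2 * K * \<bar>v - x\<bar>)"
          using n e' by (intro mult_left_mono) auto
        finally show ?thesis using K by simp
      qed
      have "(LBINT u:{p..q}. w u) \<le> A q - A p + e * (q - p)"
        if "p \<le> x" "x \<le> q" "q - p < d / (2 * K)" for p q
      proof -
        have "p \<le> q" using that by simp
        have "(LBINT u:{p..q}. w u) \<le> (LBINT u:{p..q}. P * \<xi> u + Q * \<eta> u)"
          using int\<xi> int\<eta> PQ \<xi>(1) \<eta>(1)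
          by (intro set_integral_mono intw set_integral_add set_integrable_mult_right) (auto simp: w_def)
        also have "\<dots> = P * (X q - X p) + Q * (Y q - Y p)"
          using int\<xi>[of p q] int\<eta>[of p q] by (simp add: set_integral_add X[OF \<open>p \<le> q\<close>] Y[OF \<open>p \<le> q\<close>])
        also have "\<dots> \<le> A q - A p + e * (q - p)"
          using near[of q] near[of p] that by (auto simp: abs_le_iff algebra_simps)
        finally show ?thesis .
      qed
      moreover have "0 < d / (2 * K)" using d K by simp
      ultimately show ?case by blast
    qed
    moreover have "e * (q - p) \<le> e" using that pq by (simp add: mult_left_le)
    ultimately show ?thesis using pq by auto
  qed
  then have "(LBINT u:{p..q}. w u) \<le> A q - A p" by (rule field_le_epsilon)
  then show ?thesis by (simp add: w_def A_def)
qed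

lemma four_function_inequality_interval:
  fixes f1 f2 f3 f4 :: "real \<Rightarrow> real"
  assumes ab: "a < b" and r: "0 < r" "r < 1" and s: "0 < s" "s < 1" and t: "0 < t" "t < 1"
    and m: "m = s * r + (1 - r) * t"
    and M3: "geo_expanding a b s M3" and M4: "geo_expanding a b t M4"
    and c: "0 < c"
    and [measurable]: "f1 \<in> borel_measurable borel" "f2 \<in> borel_measurable borel"
      "f3 \<in> borel_measurable borel" "f4 \<in> borel_measurable borel"
    and f1: "\<And>x. c \<le> f1 x" "\<And>x. f1 x \<le> C" and f2: "\<And>x. c \<le> f2 x" "\<And>x. f2 x \<le> C"
    and f3: "\<And>x. c \<le> f3 x" "\<And>x. f3 x \<le> C" and f4: "\<And>x. c \<le> f4 x" "\<And>x. f4 x \<le> C"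
    and le: "\<And>x y. x \<in> {a..b} \<Longrightarrow> y \<in> {a..b} \<Longrightarrow>
      f1 x powr m * f2 y powr (1 - m) \<le> f3 (M3 x y) powr r * f4 (M4 x y) powr (1 - r)"
  shows "(LBINT x:{a..b}. f1 x) powr m * (LBINT x:{a..b}. f2 x) powr (1 - m)
       \<le> (LBINT x:{a..b}. f3 x) powr r * (LBINT x:{a..b}. f4 x) powr (1 - r)"
proof -
  have pos: "0 < f1 x" "0 < f2 x" "0 < f3 x" "0 < f4 x" for x
    using c f1(1)[of x] f2(1)[of x] f3(1)[of x] f4(1)[of x] by linarith+
  note nn = pos[THEN less_imp_le]
  have intpos: "0 < (LBINT x:{a..b}. f x)"
    if [measurable]: "f \<in> borel_measurable borel" and "\<And>x. c \<le> f x" "\<And>x. f x \<le> C" for f :: "real \<Rightarrow> real"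
  proof -
    have "0 \<le> f x" for x using c that(2)[of x] by linarith
    then have "c * (b - a) \<le> (LBINT x:{a..b}. f x)"
      using set_integral_mono[OF set_integrable_Icc_const set_integrable_bounded_Icc[OF that(1) _ that(3)] that(2)]
        set_integral_Icc_const[of a b c] ab by (metis less_imp_le)
    moreover have "0 < c * (b - a)" using c ab by simp
    ultimately show ?thesis by linarith
  qed
  define F1 F2 F3 F4 where F_defs: "F1 = (LBINT x:{a..b}. f1 x)" "F2 = (LBINT x:{a..b}. f2 x)"
    "F3 = (LBINT x:{a..b}. f3 x)" "F4 = (LBINT x:{a..b}. f4 x)"
  have F: "0 < F1" "0 < F2" "0 < F3" "0 < F4"
    unfolding F_defs using f1 f2 f3 f4 by (auto intro!: intpos)
  obtain X :: "real \<Rightarrow> real" where X: "X 0 = a" "X 1 = b" "mono X"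
    "\<And>u v. u \<le> v \<Longrightarrow> (LBINT w:{u..v}. F1 / f1 (X w)) = X v - X u"
    using quantile_exists[of f1 c C a b] c f1 ab unfolding F_defs by auto
  obtain Y :: "real \<Rightarrow> real" where Y: "Y 0 = a" "Y 1 = b" "mono Y"
    "\<And>u v. u \<le> v \<Longrightarrow> (LBINT w:{u..v}. F2 / f2 (Y w)) = Y v - Y u"
    using quantile_exists[of f2 c C a b] c f2 ab unfolding F_defs by auto
  have [measurable]: "X \<in> borel_measurable borel" "Y \<in> borel_measurable borel"
    using borel_measurable_mono[OF X(3)] borel_measurable_mono[OF Y(3)] by auto
  \<comment> \<open>These stand in for X' and Y'; the bound \<open>K\<close> on both comes from f1,
    f2 \<ge> c.\<close>
  define \<xi> \<eta> where \<xi>_def: "\<xi> u = F1 / f1 (X u)" and \<eta>_def: "\<eta> u = F2 / f2 (Y u)" for u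
  have [measurable]: "\<xi> \<in> borel_measurable borel" "\<eta> \<in> borel_measurable borel"
    unfolding \<xi>_def \<eta>_def by measurable
  define K where "K = max (F1 / c) (F2 / c)"
  have \<xi>: "0 < \<xi> u" "\<xi> u \<le> K" and \<eta>: "0 < \<eta> u" "\<eta> u \<le> K" for u
  proof -
    show "0 < \<xi> u" "0 < \<eta> u" using pos F by (auto simp: \<xi>_def \<eta>_def)
    have "\<xi> u \<le> F1 / c" "\<eta> u \<le> F2 / c"
      unfolding \<xi>_def \<eta>_def using F pos f1 f2 c by (auto intro!: divide_left_mono mult_pos_pos)
    then show "\<xi> u \<le> K" "\<eta> u \<le> K" by (auto simp: K_def)
  qed
  have range: "X u \<in> {a..b}" "Y u \<in> {a..b}" if "u \<in> {0..1}" for u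
    using monoD[OF X(3), of 0 u] monoD[OF X(3), of u 1] monoD[OF Y(3), of 0 u] monoD[OF Y(3), of u 1]
      that X Y by auto
  have cont: "continuous_on {0..1} Z"
    if Z: "mono Z" "\<And>u v. u \<le> v \<Longrightarrow> (LBINT w:{u..v}. \<zeta> w) = Z v - Z u"
      and \<zeta>: "\<And>u. 0 < \<zeta> u" "\<And>u. \<zeta> u \<le> K" "\<zeta> \<in> borel_measurable borel" for Z \<zeta> :: "real \<Rightarrow> real"
  proof -
    have "Z v - Z u \<le> K * (v - u)" if "u \<le> v" for u v
      using set_integral_mono[OF set_integrable_bounded_Icc[OF \<zeta>(3) \<zeta>(1)[THEN less_imp_le] \<zeta>(2)]
          set_integrable_Icc_const \<zeta>(2), of u v]
        Z(2)[OF that] set_integral_Icc_const[OF that, of K]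
      by simp
    moreover have "0 \<le> K" using \<xi>[of 0] by linarith
    ultimately have "continuous_on UNIV Z"
      using lipschitz_on_mono_increment[OF Z(1)] lipschitz_on_continuous_on by blast
    then show ?thesis by (rule continuous_on_subset) simp
  qed
  have contX: "continuous_on {0..1} X"
    using X(3,4) \<xi> by (intro cont[where \<zeta> = \<xi>]) (auto simp: \<xi>_def)
  have contY: "continuous_on {0..1} Y"
    using Y(3,4) \<eta> by (intro cont[where \<zeta> = \<eta>]) (auto simp: \<eta>_def)
  define w where "w \<sigma> u = \<xi> u powr \<sigma> * \<eta> u powr (1 - \<sigma>)" for \<sigma> u
  have wm[measurable]: "w \<sigma> \<in> borel_measurable borel" for \<sigma> unfolding w_def by measurable
  have transport: "set_integrable lborel {0..1} (\<lambda>u. f (M (X u) (Y u)) * w \<sigma> u)"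
    "(LBINT u:{0..1}. f (M (X u) (Y u)) * w \<sigma> u) \<le> (LBINT x:{a..b}. f x)"
    if M: "geo_expanding a b \<sigma> M" and \<sigma>: "0 < \<sigma>" "\<sigma> < 1"
      and fm: "f \<in> borel_measurable borel" and f: "\<And>x. 0 \<le> f x" "\<And>x. f x \<le> C" for M f \<sigma>
  proof -
    have cont: "continuous_on {0..1} (\<lambda>u. M (X u) (Y u))"
    proof -
      have "continuous_on ({a..b} \<times> {a..b}) (\<lambda>z. M (fst z) (snd z))"
      proof (rule continuous_at_imp_continuous_on, clarify)
        fix x y assume "x \<in> {a..b}" "y \<in> {a..b}"
        then show "isCont (\<lambda>z. M (fst z) (snd z)) (x, y)"
          using M has_derivative_continuous unfolding geo_expanding_def by blast
      qed
      from continuous_on_compose2[OF this continuous_on_Pair[OF contX contY]]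
      show ?thesis using range by (simp add: image_subset_iff)
    qed
    have ran: "M (X u) (Y u) \<in> {a..b}" if "u \<in> {0..1}" for u
      using M range[OF that] unfolding geo_expanding_def by blast
    have incr: "(LBINT u:{p..q}. w \<sigma> u) \<le> M (X q) (Y q) - M (X p) (Y p)"
      if "0 \<le> p" "p \<le> q" "q \<le> 1" for p q
      unfolding w_def
      by (rule geo_expanding_increment[OF M \<sigma> _ _ \<xi> \<eta> _ _ range that])
         (use X(4) Y(4) in \<open>auto simp: \<xi>_def \<eta>_def\<close>)
    have w0: "0 \<le> w \<sigma> u" for u by (simp add: w_def)
    have wK: "w \<sigma> u \<le> K" for u
      unfolding w_def using \<xi> \<eta> \<sigma> by (intro powr_weighted_le) auto
    note * = integral_ge_along_expanding_map[OF cont ran wm w0 wK fm f incr]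
    show "set_integrable lborel {0..1} (\<lambda>u. f (M (X u) (Y u)) * w \<sigma> u)"
      "(LBINT u:{0..1}. f (M (X u) (Y u)) * w \<sigma> u) \<le> (LBINT x:{a..b}. f x)"
      using * by auto
  qed
  note T3 = transport[OF M3 s, of f3, OF _ nn(3) f3(2)]
  note T4 = transport[OF M4 t, of f4, OF _ nn(4) f4(2)]
  \<comment> \<open>The quotient of the two sides of the claim. It is a constant lying below an
    integrand on [0, 1] whose integral is at most r + (1 - r) = 1.\<close>
  define \<theta> where "\<theta> = F1 powr m * F2 powr (1 - m) / (F3 powr r * F4 powr (1 - r))"
  have pointwise: "\<theta> \<le> r / F3 * (f3 (M3 (X u) (Y u)) * w s u) + (1 - r) / F4 * (f4 (M4 (X u) (Y u)) * w t u)"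
    if u: "u \<in> {0..1}" for u
  proof -
    let ?g3 = "f3 (M3 (X u) (Y u))" and ?g4 = "f4 (M4 (X u) (Y u))"
    have wpos: "0 < w s u" "0 < w t u" using \<xi>(1)[of u] \<eta>(1)[of u] by (auto simp: w_def)
    \<comment> \<open>This is where the value of \<open>m\<close> enters: the weights
      \<open>w s\<close> and \<open>w t\<close>, averaged geometrically with exponents r and 1 - r,
      give exactly \<xi>^m \<eta>^(1-m), which completes f1(X)^m f2(Y)^(1-m) to a constant.\<close>
    have e: "(1 - s) * r + (1 - t) * (1 - r) = 1 - m" "s * r + t * (1 - r) = m"
      by (auto simp: m algebra_simps)
    have "F1 powr m * F2 powr (1 - m)
        = (f1 (X u) powr m * f2 (Y u) powr (1 - m)) * (\<xi> u powr m * \<eta> u powr (1 - m))"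
      using pos(1)[of "X u"] pos(2)[of "Y u"] F by (simp add: \<xi>_def \<eta>_def powr_divide)
    also have "\<dots> \<le> (?g3 powr r * ?g4 powr (1 - r)) * (\<xi> u powr m * \<eta> u powr (1 - m))"
      using le[OF range[OF u]] by (intro mult_right_mono) auto
    also have "\<xi> u powr m * \<eta> u powr (1 - m) = w s u powr r * w t u powr (1 - r)"
    proof -
      have "\<xi> u powr m = (\<xi> u powr s) powr r * (\<xi> u powr t) powr (1 - r)"
        "\<eta> u powr (1 - m) = (\<eta> u powr (1 - s)) powr r * (\<eta> u powr (1 - t)) powr (1 - r)"
        by (simp_all only: powr_powr powr_add[symmetric] e)
      then show ?thesis by (simp add: w_def powr_mult)
    qed
    finally have "\<theta> \<le> (?g3 powr r * ?g4 powr (1 - r)) * (w s u powr r * w t u powr (1 - r)) / (F3 powr r * F4 powr (1 - r))"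
      unfolding \<theta>_def by (intro divide_right_mono) auto
    also have "\<dots> = (?g3 * w s u / F3) powr r * (?g4 * w t u / F4) powr (1 - r)"
      using pos(3)[of "M3 (X u) (Y u)"] pos(4)[of "M4 (X u) (Y u)"] wpos F
      by (simp add: powr_mult powr_divide)
    also have "\<dots> \<le> r * (?g3 * w s u / F3) + (1 - r) * (?g4 * w t u / F4)"
      using r pos wpos F by (intro Youngs_inequality_0) auto
    finally show ?thesis by simp
  qed
  have "\<theta> = (LBINT u:{0..1::real}. \<theta>)" using set_integral_Icc_const[of 0 1 \<theta>] by simp
  also have "\<dots> \<le> (LBINT u:{0..1}. r / F3 * (f3 (M3 (X u) (Y u)) * w s u) + (1 - r) / F4 * (f4 (M4 (X u) (Y u)) * w t u))"
    using T3(1) T4(1) pointwise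
    by (intro set_integral_mono set_integrable_Icc_const set_integral_add(1) set_integrable_mult_right) auto
  also have "\<dots> = r / F3 * (LBINT u:{0..1}. f3 (M3 (X u) (Y u)) * w s u) + (1 - r) / F4 * (LBINT u:{0..1}. f4 (M4 (X u) (Y u)) * w t u)"
    using T3(1) T4(1) 
    by (subst set_integral_add(2)) (auto intro!: set_integrable_mult_right)
  also have "\<dots> \<le> r / F3 * F3 + (1 - r) / F4 * F4"
    using T3(2) T4(2) r F unfolding F_defs[symmetric] by (intro add_mono mult_left_mono) auto
  also have "\<dots> = 1" using F by simp
  finally have "\<theta> \<le> 1" .
  then have "F1 powr m * F2 powr (1 - m) \<le> F3 powr r * F4 powr (1 - r)"
    using F by (simp add: \<theta>_def divide_le_eq)
  then show ?thesis by (simp add: F_defs)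
qed

section \<open>Power means\<close>

lemma powmean_Icc:
  assumes "0 < a" "x \<in> {a..b}" "y \<in> {a..b}" "0 \<le> \<alpha>" "0 < s" "s < 1"
  shows "powmean \<alpha> s x y \<in> {a..b}"
proof (cases "\<alpha> = 0")
  case True
  have "a powr s * a powr (1 - s) \<le> x powr s * y powr (1 - s)"
       "x powr s * y powr (1 - s) \<le> b powr s * b powr (1 - s)"
    using assms by (auto intro!: mult_mono powr_mono2)
  then show ?thesis
    using assms True by (simp add: powmean_def powr_add[symmetric])
next
  case False
  have "s * a powr \<alpha> + (1 - s) * a powr \<alpha> \<le> s * x powr \<alpha> + (1 - s) * y powr \<alpha>"
       "s * x powr \<alpha> + (1 - s) * y powr \<alpha> \<le> s * b powr \<alpha> + (1 - s) * b powr \<alpha>"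
    using assms by (auto intro!: add_mono mult_left_mono powr_mono2)
  moreover define S where "S = s * x powr \<alpha> + (1 - s) * y powr \<alpha>"
  ultimately have "a powr \<alpha> \<le> S" "S \<le> b powr \<alpha>"
    by (auto simp: algebra_simps)
  then have "(a powr \<alpha>) powr (1 / \<alpha>) \<le> S powr (1 / \<alpha>)" "S powr (1 / \<alpha>) \<le> (b powr \<alpha>) powr (1 / \<alpha>)"
    using assms by (auto intro!: powr_mono2 simp: S_def)
  then show ?thesis using assms False by (simp add: powmean_def powr_powr S_def)
qed

lemma powmean_ge_geometric:
  assumes "0 < x" "0 < y" "0 \<le> \<alpha>" "0 < s" "s < 1"
  shows "x powr s * y powr (1 - s) \<le> powmean \<alpha> s x y"
proof (cases "\<alpha> = 0")
  case False
  have "(x powr \<alpha>) powr s * (y powr \<alpha>) powr (1 - s) \<le> s * x powr \<alpha> + (1 - s) * y powr \<alpha>"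
    using assms by (intro Youngs_inequality_0) auto
  then have "((x powr \<alpha>) powr s * (y powr \<alpha>) powr (1 - s)) powr (1 / \<alpha>)
      \<le> (s * x powr \<alpha> + (1 - s) * y powr \<alpha>) powr (1 / \<alpha>)"
    using assms by (intro powr_mono2) auto
  then show ?thesis
    using assms False by (simp add: powmean_def powr_powr powr_mult)
qed (simp add: powmean_def)

text \<open>Expressing the partial derivatives through the mean M itself, as s (M/x)^(1-\<alpha>)
  and (1-s) (M/y)^(1-\<alpha>), gives one formula for \<alpha> = 0 and \<alpha> \<noteq> 0.\<close>

lemma has_derivative_powmean:
  assumes "0 < x" "0 < y" "0 < s" "s < 1"
  shows "((\<lambda>z. powmean \<alpha> s (fst z) (snd z)) has_derivative
     (\<lambda>h. (s * x powr (\<alpha> - 1) * powmean \<alpha> s x y powr (1 - \<alpha>)) * fst h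
        + ((1 - s) * y powr (\<alpha> - 1) * powmean \<alpha> s x y powr (1 - \<alpha>)) * snd h)) (at (x, y))"
proof (cases "\<alpha> = 0")
  case True
  have "((\<lambda>z. fst z powr s * snd z powr (1 - s)) has_derivative
     (\<lambda>h. x powr s * (y powr (1 - s) * (snd h * (1 - s) / y)) + x powr s * (fst h * s / x) * y powr (1 - s))) (at (x, y))"
    using assms by (auto intro!: derivative_eq_intros)
  also have "(\<lambda>h. x powr s * (y powr (1 - s) * (snd h * (1 - s) / y)) + x powr s * (fst h * s / x) * y powr (1 - s))
     = (\<lambda>h. (s * x powr (- 1) * (x powr s * y powr (1 - s))) * fst h
          + ((1 - s) * y powr (- 1) * (x powr s * y powr (1 - s))) * snd h)"
    using assms by (simp add: fun_eq_iff powr_minus divide_inverse mult_ac add.commute)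
  finally show ?thesis
    using assms True by (simp add: powmean_def)
next
  case False
  define S where "S = s * x powr \<alpha> + (1 - s) * y powr \<alpha>"
  have S: "0 < S" using assms by (auto simp: S_def intro!: add_pos_pos)
  have M: "(S powr (1 / \<alpha>)) powr (1 - \<alpha>) = S powr (1 / \<alpha>) / S"
    using S False by (simp add: powr_powr diff_divide_distrib powr_diff left_diff_distrib right_diff_distrib)
  have "((\<lambda>z. (s * fst z powr \<alpha> + (1 - s) * snd z powr \<alpha>) powr (1 / \<alpha>)) has_derivative
     (\<lambda>h. S powr (1 / \<alpha>) * ((s * (x powr \<alpha> * (fst h * \<alpha> / x)) + (1 - s) * (y powr \<alpha> * (snd h * \<alpha> / y))) * (1 / \<alpha>) / S))) (at (x, y))"
    using assms S by (auto intro!: derivative_eq_intros simp: S_def)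
  also have "(\<lambda>h. S powr (1 / \<alpha>) * ((s * (x powr \<alpha> * (fst h * \<alpha> / x)) + (1 - s) * (y powr \<alpha> * (snd h * \<alpha> / y))) * (1 / \<alpha>) / S))
     = (\<lambda>h. (s * x powr (\<alpha> - 1) * (S powr (1 / \<alpha>)) powr (1 - \<alpha>)) * fst h
        + ((1 - s) * y powr (\<alpha> - 1) * (S powr (1 / \<alpha>)) powr (1 - \<alpha>)) * snd h)"
    unfolding M using assms S False by (auto simp: fun_eq_iff powr_diff field_simps)
  finally show ?thesis
    using False by (simp add: powmean_def S_def)
qed

text \<open>AM-GM applied to x^(\<alpha>-1) \<xi> and y^(\<alpha>-1) \<eta> bounds the differential
  below by \<xi>^s \<eta>^(1-s) (M/g)^(1-\<alpha>), where g is the geometric mean of x and y. The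
  last factor is at least 1 because M \<ge> g and 1 - \<alpha> \<ge> 0.\<close>

lemma geo_expanding_powmean:
  assumes "0 < a" "0 \<le> \<alpha>" "\<alpha> \<le> 1" "0 < s" "s < 1"
  shows "geo_expanding a b s (powmean \<alpha> s)"
  unfolding geo_expanding_def
proof (intro ballI conjI)
  fix x y assume xy: "x \<in> {a..b}" "y \<in> {a..b}"
  then show "powmean \<alpha> s x y \<in> {a..b}" using assms by (intro powmean_Icc) auto
  have pos: "0 < x" "0 < y" using xy assms by auto
  define M where "M = powmean \<alpha> s x y"
  have "\<xi> powr s * \<eta> powr (1 - s)
      \<le> (s * x powr (\<alpha> - 1) * M powr (1 - \<alpha>)) * \<xi> + ((1 - s) * y powr (\<alpha> - 1) * M powr (1 - \<alpha>)) * \<eta>"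
    if "0 < \<xi>" "0 < \<eta>" for \<xi> \<eta>
  proof -
    let ?g = "x powr s * y powr (1 - s)"
    have g: "0 < ?g" using pos by simp
    have "(x powr (\<alpha> - 1)) powr s * (y powr (\<alpha> - 1)) powr (1 - s) = ?g powr (\<alpha> - 1)"
      using pos by (simp add: powr_powr powr_mult mult.commute)
    then have "\<xi> powr s * \<eta> powr (1 - s)
        = ((x powr (\<alpha> - 1) * \<xi>) powr s * (y powr (\<alpha> - 1) * \<eta>) powr (1 - s)) * ?g powr (1 - \<alpha>)"
      using g pos that by (simp add: powr_mult mult_ac powr_add[symmetric])
    also have "\<dots> \<le> (s * (x powr (\<alpha> - 1) * \<xi>) + (1 - s) * (y powr (\<alpha> - 1) * \<eta>)) * M powr (1 - \<alpha>)"
      using assms pos that powmean_ge_geometric[of x y \<alpha> s] g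
      by (intro mult_mono Youngs_inequality_0 powr_mono2) (auto simp: M_def)
    finally show ?thesis by (simp add: algebra_simps)
  qed
  with has_derivative_powmean[OF pos assms(4,5), of \<alpha>]
  show "\<exists>P Q. ((\<lambda>z. powmean \<alpha> s (fst z) (snd z)) has_derivative (\<lambda>h. P * fst h + Q * snd h)) (at (x, y)) \<and>
            (\<forall>\<xi>>0. \<forall>\<eta>>0. \<xi> powr s * \<eta> powr (1 - s) \<le> P * \<xi> + Q * \<eta>)"
    unfolding M_def by blast
qed

section \<open>Products of intervals\<close>

text \<open>A density, unlike a restriction of the space, keeps all Borel sets of the line, so
  products over it have the same measurable sets as products of \<open>lborel\<close>.\<close>

definition interval_lborel :: "real \<Rightarrow> real \<Rightarrow> real measure" where
  "interval_lborel a b = density lborel (\<lambda>x. ennreal (indicator {a..b} x))"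

lemma sets_interval_lborel [simp, measurable_cong]: "sets (interval_lborel a b) = sets borel"
  by (simp add: interval_lborel_def)

lemma space_interval_lborel [simp]: "space (interval_lborel a b) = UNIV"
  by (simp add: interval_lborel_def)

lemma integral_interval_lborel:
  fixes f :: "real \<Rightarrow> real"
  shows "f \<in> borel_measurable borel \<Longrightarrow> integral\<^sup>L (interval_lborel a b) f = (LBINT x:{a..b}. f x)"
  unfolding interval_lborel_def set_lebesgue_integral_def by (subst integral_density) auto

lemma emeasure_interval_lborel:
  "A \<in> sets borel \<Longrightarrow> emeasure (interval_lborel a b) A = emeasure lborel ({a..b} \<inter> A)"
  unfolding interval_lborel_def
  by (subst emeasure_density) (auto simp: nn_integral_indicator[symmetric] indicator_inter_arith
      ennreal_indicator simp del: nn_integral_indicator intro!: nn_integral_cong)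

lemma finite_measure_interval_lborel: "finite_measure (interval_lborel a b)"
  by (rule finite_measureI) (cases "a \<le> b"; simp add: emeasure_interval_lborel)

lemma product_sigma_finite_interval_lborel: "product_sigma_finite (\<lambda>_. interval_lborel a b)"
proof -
  interpret finite_measure "interval_lborel a b" by (rule finite_measure_interval_lborel)
  show ?thesis by unfold_locales
qed

lemma finite_measure_PiM_interval_lborel:
  assumes "finite I"
  shows "finite_measure (PiM I (\<lambda>_. interval_lborel a b))"
proof -
  interpret product_sigma_finite "\<lambda>_. interval_lborel a b"
    by (rule product_sigma_finite_interval_lborel)
  interpret N: finite_measure "interval_lborel a b" by (rule finite_measure_interval_lborel)
  have "emeasure (PiM I (\<lambda>_. interval_lborel a b)) (PiE I (\<lambda>_. UNIV))
      = (\<Prod>i\<in>I. emeasure (interval_lborel a b) UNIV)"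
    using assms by (intro emeasure_PiM) auto
  also have "\<dots> \<noteq> \<infinity>"
    using N.emeasure_finite by (simp only: ennreal_prod_eq_top infinity_ennreal_def) simp
  finally show ?thesis
    by (intro finite_measureI) (simp add: space_PiM)
qed

text \<open>The indicator of a box factors over the coordinates, so both measures agree on
  rectangles. This turns Lebesgue integrals over a box into integrals for a product of finite
  measures, where bounded measurable functions are integrable and can be integrated out coordinate
  by coordinate.\<close>

lemma density_PiM_lborel:
  assumes "finite I"
  shows "density (PiM I (\<lambda>_. lborel)) (\<lambda>x. ennreal (indicator (PiE I (\<lambda>_. {a..b})) x))
       = PiM I (\<lambda>_. interval_lborel a b)"
proof -
  interpret product_sigma_finite "\<lambda>_. interval_lborel a b"
    by (rule product_sigma_finite_interval_lborel)
  interpret L: product_sigma_finite "\<lambda>_. lborel :: real measure" by unfold_locales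
  have box[measurable]: "PiE I (\<lambda>_. {a..b}) \<in> sets (PiM I (\<lambda>_. lborel :: real measure))"
    using assms by (intro sets_PiM_I_finite) auto
  show ?thesis
  proof (rule PiM_eqI[OF assms])
    show "sets (density (PiM I (\<lambda>_. lborel)) (\<lambda>x. ennreal (indicator (PiE I (\<lambda>_. {a..b})) x)))
        = sets (PiM I (\<lambda>_. interval_lborel a b))"
      by (simp cong: sets_PiM_cong)
    fix A assume A: "\<And>i. i \<in> I \<Longrightarrow> A i \<in> sets (interval_lborel a b)"
    have [measurable]: "PiE I A \<in> sets (PiM I (\<lambda>_. lborel :: real measure))"
      using assms A by (intro sets_PiM_I_finite) auto
    have "emeasure (density (PiM I (\<lambda>_. lborel)) (\<lambda>x. ennreal (indicator (PiE I (\<lambda>_. {a..b})) x))) (PiE I A)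
       = (\<integral>\<^sup>+x. ennreal (indicator (PiE I (\<lambda>_. {a..b})) x) * indicator (PiE I A) x \<partial>PiM I (\<lambda>_. lborel))"
      by (rule emeasure_density) measurable
    also have "\<dots> = (\<integral>\<^sup>+x. indicator (PiE I (\<lambda>i. {a..b} \<inter> A i)) x \<partial>PiM I (\<lambda>_. lborel))"
      by (intro nn_integral_cong) (auto simp: indicator_def PiE_iff)
    also have "\<dots> = emeasure (PiM I (\<lambda>_. lborel)) (PiE I (\<lambda>i. {a..b} \<inter> A i))"
      using assms A by (intro nn_integral_indicator sets_PiM_I_finite) auto
    also have "\<dots> = (\<Prod>i\<in>I. emeasure (interval_lborel a b) (A i))"
      using assms A by (subst L.emeasure_PiM) (auto simp: emeasure_interval_lborel intro!: prod.cong)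
    finally show "emeasure (density (PiM I (\<lambda>_. lborel)) (\<lambda>x. ennreal (indicator (PiE I (\<lambda>_. {a..b})) x))) (PiE I A)
       = (\<Prod>i\<in>I. emeasure (interval_lborel a b) (A i))" .
  qed
qed

text \<open>For fixed x and y in the smaller box, the slices in the new coordinate satisfy the
  one-dimensional hypothesis, and the one-dimensional conclusion for them is precisely the
  hypothesis for the marginals. The induction generalises the bounds too, since marginals are
  bounded by c (b - a) and C (b - a).\<close>

lemma four_function_inequality_product:
  fixes f1 f2 f3 f4 :: "('i \<Rightarrow> real) \<Rightarrow> real"
  assumes I: "finite I"
    and ab: "a < b" and r: "0 < r" "r < 1" and s: "0 < s" "s < 1" and t: "0 < t" "t < 1"
    and m: "m = s * r + (1 - r) * t"
    and M3: "geo_expanding a b s M3" and M4: "geo_expanding a b t M4"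
    and c: "0 < c"
    and "f1 \<in> borel_measurable (PiM I (\<lambda>_. interval_lborel a b))"
      "f2 \<in> borel_measurable (PiM I (\<lambda>_. interval_lborel a b))"
      "f3 \<in> borel_measurable (PiM I (\<lambda>_. interval_lborel a b))"
      "f4 \<in> borel_measurable (PiM I (\<lambda>_. interval_lborel a b))"
    and "f1 \<in> extensional I \<rightarrow> {c..C}" "f2 \<in> extensional I \<rightarrow> {c..C}"
      "f3 \<in> extensional I \<rightarrow> {c..C}" "f4 \<in> extensional I \<rightarrow> {c..C}"
    and "\<And>x y. x \<in> PiE I (\<lambda>_. {a..b}) \<Longrightarrow> y \<in> PiE I (\<lambda>_. {a..b}) \<Longrightarrow>
      f1 x powr m * f2 y powr (1 - m)
        \<le> f3 (\<lambda>i\<in>I. M3 (x i) (y i)) powr r * f4 (\<lambda>i\<in>I. M4 (x i) (y i)) powr (1 - r)"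
  shows "integral\<^sup>L (PiM I (\<lambda>_. interval_lborel a b)) f1 powr m * integral\<^sup>L (PiM I (\<lambda>_. interval_lborel a b)) f2 powr (1 - m)
     \<le> integral\<^sup>L (PiM I (\<lambda>_. interval_lborel a b)) f3 powr r * integral\<^sup>L (PiM I (\<lambda>_. interval_lborel a b)) f4 powr (1 - r)"
  using I assms(12-)
proof (induction I arbitrary: f1 f2 f3 f4 c C rule: finite_induct)
  \<comment> \<open>The product measure over no coordinates is a unit point mass, so the claim is
    the hypothesis at its only point.\<close>
  case empty
  have "integral\<^sup>L (PiM {} (\<lambda>_. interval_lborel a b)) f = f (\<lambda>_. undefined)" for f :: "('i \<Rightarrow> real) \<Rightarrow> real"
    by (simp add: PiM_empty lebesgue_integral_count_space_finite)
  moreover have "(\<lambda>i\<in>{}. g i) = (\<lambda>_. undefined)" for g :: "'i \<Rightarrow> real"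
    by (simp add: restrict_def)
  ultimately show ?case
    using empty(10)[of "\<lambda>_. undefined" "\<lambda>_. undefined"] by simp
next
  case (insert i I)
  let ?N = "interval_lborel a b"
  let ?P = "\<lambda>I. PiM I (\<lambda>_. ?N)"
  interpret product_sigma_finite "\<lambda>_. ?N" by (rule product_sigma_finite_interval_lborel)
  interpret N: finite_measure ?N by (rule finite_measure_interval_lborel)
  define marg where "marg f x = (\<integral>u. f (x(i := u)) \<partial>?N)" for f :: "('i \<Rightarrow> real) \<Rightarrow> real" and x
  have ext_upd: "x(i := u) \<in> extensional (insert i I)" if "x \<in> extensional I" for x u
    using that by (auto simp: extensional_def)
  have slice: "(\<lambda>u. f (x(i := u))) \<in> borel_measurable borel"
    if "f \<in> borel_measurable (?P (insert i I))" "x \<in> extensional I" for f x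
  proof -
    have "(\<lambda>u. x(i := u)) \<in> measurable ?N (?P (insert i I))"
      using that(2) insert.hyps by (intro measurable_component_update) (auto simp: space_PiM PiE_def)
    from measurable_compose[OF this that(1)] show ?thesis by simp
  qed
  have marg: "marg f \<in> borel_measurable (?P I)" "marg f \<in> extensional I \<rightarrow> {c * (b - a)..C * (b - a)}"
     "integral\<^sup>L (?P (insert i I)) f = integral\<^sup>L (?P I) (marg f)"
     "\<And>x. x \<in> extensional I \<Longrightarrow> marg f x = (LBINT u:{a..b}. f (x(i := u)))"
    if f: "f \<in> borel_measurable (?P (insert i I))" "f \<in> extensional (insert i I) \<rightarrow> {c..C}" for f
  proof -
    note [measurable] = f(1)
    show "marg f \<in> borel_measurable (?P I)"
      unfolding marg_def by (rule borel_measurable_lebesgue_integral) measurable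
    show eq: "marg f x = (LBINT u:{a..b}. f (x(i := u)))" if "x \<in> extensional I" for x
      unfolding marg_def by (rule integral_interval_lborel[OF slice[OF f(1) that]])
    show "marg f \<in> extensional I \<rightarrow> {c * (b - a)..C * (b - a)}"
    proof
      fix x :: "'i \<Rightarrow> real" assume x: "x \<in> extensional I"
      have bd: "c \<le> f (x(i := u))" "f (x(i := u)) \<le> C" "0 \<le> f (x(i := u))" for u
        using f(2) ext_upd[OF x, of u] insert.prems(1) by (auto simp: Pi_iff intro: order_trans[of 0 c])
      have int: "set_integrable lborel {a..b} (\<lambda>u. f (x(i := u)))"
        by (rule set_integrable_bounded_Icc[OF slice[OF f(1) x] bd(3,2)])
      show "marg f x \<in> {c * (b - a)..C * (b - a)}"
        using set_integral_mono[OF set_integrable_Icc_const[of a b c] int bd(1)]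
          set_integral_mono[OF int set_integrable_Icc_const[of a b C] bd(2)] ab
        by (simp add: eq[OF x] set_integral_Icc_const)
    qed
    interpret PI: finite_measure "?P (insert i I)"
      using insert.hyps by (intro finite_measure_PiM_interval_lborel) auto
    have "integrable (?P (insert i I)) f"
    proof (rule PI.integrable_const_bound[of _ C])
      have "norm (f x) \<le> C" if "x \<in> extensional (insert i I)" for x
        using Pi_mem[OF f(2) that] insert.prems(1) by simp
      then show "AE x in ?P (insert i I). norm (f x) \<le> C"
        by (intro AE_I2) (simp add: space_PiM PiE_def)
    qed (fact f(1))
    then show "integral\<^sup>L (?P (insert i I)) f = integral\<^sup>L (?P I) (marg f)"
      unfolding marg_def using insert.hyps by (intro product_integral_insert) auto
  qed
  note p = insert.prems
  note mg1 = marg[OF p(2,6)] and mg2 = marg[OF p(3,7)] and mg3 = marg[OF p(4,8)] and mg4 = marg[OF p(5,9)]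
  have "integral\<^sup>L (?P I) (marg f1) powr m * integral\<^sup>L (?P I) (marg f2) powr (1 - m)
     \<le> integral\<^sup>L (?P I) (marg f3) powr r * integral\<^sup>L (?P I) (marg f4) powr (1 - r)"
  proof (rule insert.IH)
    show "0 < c * (b - a)" using p(1) ab by simp
    fix x y assume xy: "x \<in> PiE I (\<lambda>_. {a..b})" "y \<in> PiE I (\<lambda>_. {a..b})"
    let ?m3 = "\<lambda>i\<in>I. M3 (x i) (y i)" and ?m4 = "\<lambda>i\<in>I. M4 (x i) (y i)"
    have ext: "x \<in> extensional I" "y \<in> extensional I" "?m3 \<in> extensional I" "?m4 \<in> extensional I"
      using xy by (auto simp: PiE_def)
    have bd: "c \<le> f (z(i := u))" "f (z(i := u)) \<le> C"
      if "f \<in> extensional (insert i I) \<rightarrow> {c..C}" "z \<in> extensional I" for f z u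
      using that(1) ext_upd[OF that(2), of u] by (auto simp: Pi_iff)
    show "marg f1 x powr m * marg f2 y powr (1 - m) \<le> marg f3 ?m3 powr r * marg f4 ?m4 powr (1 - r)"
      unfolding mg1(4)[OF ext(1)] mg2(4)[OF ext(2)] mg3(4)[OF ext(3)] mg4(4)[OF ext(4)]
    proof (rule four_function_inequality_interval[OF ab r s t m M3 M4 p(1)
        slice[OF p(2) ext(1)] slice[OF p(3) ext(2)] slice[OF p(4) ext(3)] slice[OF p(5) ext(4)]
        bd[OF p(6) ext(1)] bd[OF p(7) ext(2)] bd[OF p(8) ext(3)] bd[OF p(9) ext(4)]])
      fix u v assume uv: "u \<in> {a..b}" "v \<in> {a..b}"
      \<comment> \<open>Because \<open>M\<close> acts coordinatewise, the slices of f3 and f4 are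
        taken at points independent of \<open>u\<close> and \<open>v\<close>.\<close>
      have eq: "(\<lambda>j\<in>insert i I. M ((x(i := u)) j) ((y(i := v)) j)) = (\<lambda>j\<in>I. M (x j) (y j))(i := M u v)" for M :: "real \<Rightarrow> real \<Rightarrow> real"
        using insert.hyps by (auto simp: fun_eq_iff restrict_def)
      have "x(i := u) \<in> PiE (insert i I) (\<lambda>_. {a..b})" "y(i := v) \<in> PiE (insert i I) (\<lambda>_. {a..b})"
        using xy uv by (auto intro!: PiE_fun_upd)
      from p(10)[OF this] show "f1 (x(i := u)) powr m * f2 (y(i := v)) powr (1 - m)
          \<le> f3 (?m3(i := M3 u v)) powr r * f4 (?m4(i := M4 u v)) powr (1 - r)"
        unfolding eq .
    qed
  qed (fact mg1 mg2 mg3 mg4)+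
  then show ?case
    unfolding mg1(3) mg2(3) mg3(3) mg4(3) .
qed

lemma four_function_inequality_box:
  fixes h1 h2 h3 h4 :: "real^'n \<Rightarrow> real"
  assumes ab: "a < b" and r: "0 < r" "r < 1" and s: "0 < s" "s < 1" and t: "0 < t" "t < 1"
    and m: "m = s * r + (1 - r) * t"
    and M3: "geo_expanding a b s M3" and M4: "geo_expanding a b t M4"
    and c: "0 < c"
    and meas: "h1 \<in> borel_measurable borel" "h2 \<in> borel_measurable borel"
      "h3 \<in> borel_measurable borel" "h4 \<in> borel_measurable borel"
    and bd: "\<And>x. h1 x \<in> {c..C}" "\<And>x. h2 x \<in> {c..C}" "\<And>x. h3 x \<in> {c..C}" "\<And>x. h4 x \<in> {c..C}"
    and le: "\<And>x y. (\<And>i. x $ i \<in> {a..b}) \<Longrightarrow> (\<And>i. y $ i \<in> {a..b}) \<Longrightarrow>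
      h1 x powr m * h2 y powr (1 - m)
        \<le> h3 (\<chi> i. M3 (x $ i) (y $ i)) powr r * h4 (\<chi> i. M4 (x $ i) (y $ i)) powr (1 - r)"
  defines "Q \<equiv> {x. \<forall>i. x $ i \<in> {a..b}}"
  shows "(LBINT x:Q. h1 x) powr m * (LBINT x:Q. h2 x) powr (1 - m)
       \<le> (LBINT x:Q. h3 x) powr r * (LBINT x:Q. h4 x) powr (1 - r)"
proof -
  let ?B = "Basis :: (real^'n) set"
  \<comment> \<open>The map under which \<open>lborel_eq\<close> presents Lebesgue measure as the
    image of a product over \<open>Basis\<close>; coordinate j of a vector has product index
    \<open>axis j 1\<close>.\<close>
  define \<iota> where "\<iota> f = (\<Sum>b\<in>?B. f b *\<^sub>R b)" for f
  have \<iota>_nth: "\<iota> f $ j = f (axis j 1)" for f j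
    by (simp add: \<iota>_def cart_eq_inner_axis inner_sum_left_Basis)
  have basis: "b \<in> ?B \<longleftrightarrow> (\<exists>j. b = axis j 1)" for b
    by (auto simp: Basis_vec_def)
  have [measurable]: "\<iota> \<in> measurable (PiM ?B (\<lambda>_. lborel)) borel"
    unfolding \<iota>_def by measurable
  have [measurable]: "\<iota> \<in> measurable (PiM ?B (\<lambda>_. interval_lborel a b)) borel"
    unfolding \<iota>_def by measurable
  have Q: "Q = cbox (\<chi> i. a) (\<chi> i. b)"
    by (auto simp: Q_def mem_box_cart)
  have transfer: "(LBINT x:Q. h x) = integral\<^sup>L (PiM ?B (\<lambda>_. interval_lborel a b)) (\<lambda>f. h (\<iota> f))"
    if [measurable]: "h \<in> borel_measurable borel" for h :: "real^'n \<Rightarrow> real"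
  proof -
    have [measurable]: "Q \<in> sets borel" by (simp add: Q)
    have [measurable]: "PiE ?B (\<lambda>_. {a..b}) \<in> sets (PiM ?B (\<lambda>_. lborel :: real measure))"
      by (intro sets_PiM_I_finite) auto
    have "(LBINT x:Q. h x) = (LINT f|PiM ?B (\<lambda>_. lborel). indicator Q (\<iota> f) *\<^sub>R h (\<iota> f))"
      unfolding set_lebesgue_integral_def
      by (subst lborel_eq, subst integral_distr) (auto simp: \<iota>_def[symmetric])
    also have "\<dots> = (LINT f|PiM ?B (\<lambda>_. lborel). indicator (PiE ?B (\<lambda>_. {a..b})) f *\<^sub>R h (\<iota> f))"
    proof (rule Bochner_Integration.integral_cong[OF refl])
      fix f assume "f \<in> space (PiM ?B (\<lambda>_. lborel :: real measure))"
      then have "\<iota> f \<in> Q \<longleftrightarrow> f \<in> PiE ?B (\<lambda>_. {a..b})"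
        by (force simp: Q_def \<iota>_nth space_PiM PiE_iff basis)
      then show "indicator Q (\<iota> f) *\<^sub>R h (\<iota> f) = indicator (PiE ?B (\<lambda>_. {a..b})) f *\<^sub>R h (\<iota> f)"
        by (simp add: indicator_def)
    qed
    also have "\<dots> = integral\<^sup>L (PiM ?B (\<lambda>_. interval_lborel a b)) (\<lambda>f. h (\<iota> f))"
      by (subst density_PiM_lborel[symmetric], simp, subst integral_density) auto
    finally show ?thesis .
  qed
  show ?thesis
    unfolding meas[THEN transfer]
  proof (rule four_function_inequality_product[OF _ ab r s t m M3 M4 c, where C = C])
    fix x y assume xy: "x \<in> PiE ?B (\<lambda>_. {a..b})" "y \<in> PiE ?B (\<lambda>_. {a..b})"
    have eq: "\<iota> (\<lambda>i\<in>?B. M (x i) (y i)) = (\<chi> i. M (\<iota> x $ i) (\<iota> y $ i))" for M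
      by (simp add: vec_eq_iff \<iota>_nth)
    show "h1 (\<iota> x) powr m * h2 (\<iota> y) powr (1 - m)
        \<le> h3 (\<iota> (\<lambda>i\<in>?B. M3 (x i) (y i))) powr r * h4 (\<iota> (\<lambda>i\<in>?B. M4 (x i) (y i))) powr (1 - r)"
      unfolding eq
    proof (rule le)
      show "\<iota> x $ i \<in> {a..b}" "\<iota> y $ i \<in> {a..b}" for i
        unfolding \<iota>_nth using xy[THEN PiE_mem, of "axis i 1"] basis by blast+
    qed
  qed (use meas bd in \<open>auto simp: Pi_iff\<close>)
qed

section \<open>Truncation\<close>

lemma convex_combination_unit_interval:
  fixes r s t :: real
  assumes "0 < r" "r < 1" "0 < s" "s < 1" "0 < t" "t < 1"
  shows "0 < s * r + (1 - r) * t" "s * r + (1 - r) * t < 1"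
proof -
  show "0 < s * r + (1 - r) * t"
    using assms by (intro add_pos_pos mult_pos_pos) auto
  have "s * r + (1 - r) * t < 1 * r + (1 - r) * 1"
    using assms by (intro add_strict_mono mult_strict_right_mono mult_strict_left_mono) auto
  then show "s * r + (1 - r) * t < 1" by simp
qed

text \<open>Integrability of \<open>f\<close> on \<open>S\<close> yields only Lebesgue
  measurability, while the transport needs Borel functions. The null set \<open>Z\<close> is named
  instead of hidden in an almost-everywhere statement, because the hypothesis is later used at four
  related points at once.\<close>

lemma integrable_on_Borel_representative:
  fixes f :: "real^'n \<Rightarrow> real"
  assumes S: "S \<in> sets borel" and f: "f integrable_on S" and nn: "\<And>x. x \<in> S \<Longrightarrow> 0 \<le> f x"
  obtains g Z where "integrable lborel g" "integral\<^sup>L lborel g = integral S f" "Z \<in> null_sets lborel"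
    "\<And>x. x \<notin> Z \<Longrightarrow> g x = indicator S x * f x"
proof -
  have "f absolutely_integrable_on S"
    using f nn by (rule nonnegative_absolutely_integrable_1)
  then have int: "integrable lebesgue (\<lambda>x. indicator S x * f x)"
    and eq: "integral\<^sup>L lebesgue (\<lambda>x. indicator S x * f x) = integral S f"
    using set_lebesgue_integral_eq_integral(2)[of S f]
    by (auto simp: set_integrable_def set_lebesgue_integral_def)
  from completion_ex_borel_measurable_real[OF borel_measurable_integrable[OF int]]
  obtain g where [measurable]: "g \<in> borel_measurable lborel"
    and ae: "AE x in lborel. indicator S x * f x = g x" by auto
  have ae': "AE x in lebesgue. indicator S x * f x = g x"
    using ae by (rule AE_completion)
  have gm: "g \<in> borel_measurable lebesgue" by (rule measurable_completion) simp
  have "integrable lebesgue g"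
    using int ae' gm by (subst integrable_cong_AE[symmetric]) auto
  then have "integrable lborel g" by (simp add: integrable_completion)
  moreover have "integral\<^sup>L lborel g = integral S f"
    using integral_cong_AE[OF borel_measurable_integrable[OF int] gm ae'] eq
    by (simp add: integral_completion)
  moreover obtain Z where "\<And>x. x \<in> space lborel - Z \<Longrightarrow> indicator S x * f x = g x" "Z \<in> null_sets lborel"
    using AE_E3[OF ae] by blast
  ultimately show thesis by (intro that[of g Z]) auto
qed

text \<open>Capping g1, g2 at \<open>K\<close> and raising g3, g4 to a floor \<open>e\<close>
  respects the hypothesis. The opposite cut-offs, a positive floor for g1, g2 and a ceiling for g3,
  g4, may violate it, but are needed to have functions bounded away from 0 and infinity; their
  levels are chosen last, depending on \<open>K\<close> and \<open>e\<close>, and leave no trace in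
  the conclusion.\<close>

lemma four_function_inequality_truncated:
  fixes g1 g2 g3 g4 :: "real^'n \<Rightarrow> real"
  assumes K: "1 < K" and e: "0 < e" "e \<le> 1"
    and r: "0 < r" "r < 1" and s: "0 < s" "s < 1" and t: "0 < t" "t < 1"
    and m: "m = s * r + (1 - r) * t"
    and \<alpha>: "0 \<le> \<alpha>" "\<alpha> \<le> 1" and \<beta>: "0 \<le> \<beta>" "\<beta> \<le> 1"
    and int: "integrable lborel g1" "integrable lborel g2" "integrable lborel g3" "integrable lborel g4"
    and Z: "Z \<in> null_sets lborel"
    and nn: "\<And>x. x \<notin> Z \<Longrightarrow> 0 \<le> g1 x" "\<And>x. x \<notin> Z \<Longrightarrow> 0 \<le> g2 x"
      "\<And>x. x \<notin> Z \<Longrightarrow> 0 \<le> g3 x" "\<And>x. x \<notin> Z \<Longrightarrow> 0 \<le> g4 x"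
    and le: "\<And>x y. x \<in> pos_orthant - Z \<Longrightarrow> y \<in> pos_orthant - Z \<Longrightarrow>
      vpowmean \<alpha> s x y \<in> pos_orthant - Z \<Longrightarrow> vpowmean \<beta> t x y \<in> pos_orthant - Z \<Longrightarrow>
      g1 x powr m * g2 y powr (1 - m)
        \<le> g3 (vpowmean \<alpha> s x y) powr r * g4 (vpowmean \<beta> t x y) powr (1 - r)"
  defines "Q \<equiv> {x. \<forall>i. x $ i \<in> {1/K..K}}"
  shows "(LBINT x:Q. min (g1 x) K) powr m * (LBINT x:Q. min (g2 x) K) powr (1 - m)
      \<le> (integral\<^sup>L lborel g3 + e * measure lborel Q) powr r * (integral\<^sup>L lborel g4 + e * measure lborel Q) powr (1 - r)"
proof -
  note [measurable] = int[THEN borel_measurable_integrable]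
  have [measurable]: "Z \<in> sets borel" using Z by auto
  have m01: "0 < m" "m < 1"
    using convex_combination_unit_interval[OF r s t] by (auto simp: m)
  have small: "\<exists>d0>0. \<forall>d. 0 < d \<and> d \<le> d0 \<longrightarrow> d powr p * A \<le> e" if "0 < p" "0 < A" for p A :: real
  proof (intro exI[of _ "(e / A) powr (1 / p)"] conjI allI impI)
    fix d assume "0 < d \<and> d \<le> (e / A) powr (1 / p)"
    then have "d powr p \<le> ((e / A) powr (1 / p)) powr p" using that by (intro powr_mono2) auto
    then show "d powr p * A \<le> e" using that e by (simp add: powr_powr field_simps)
  qed (use that e in auto)
  have large: "\<exists>N0. \<forall>N\<ge>N0. K \<le> N powr p * A" if "0 < p" "0 < A" for p A :: real
  proof (intro exI[of _ "(K / A) powr (1 / p)"] allI impI)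
    fix N assume "(K / A) powr (1 / p) \<le> N"
    then have "((K / A) powr (1 / p)) powr p \<le> N powr p" using that by (intro powr_mono2) auto
    then show "K \<le> N powr p * A" using that K by (simp add: powr_powr field_simps)
  qed
  \<comment> \<open>With one factor on the left equal to the floor \<open>d\<close> and the other at
    most \<open>K\<close>, the left side is at most \<open>e\<close>; the right side is always at
    least e^r e^(1-r) = e.\<close>
  obtain d1 d2 where d12: "0 < d1" "0 < d2" "\<And>d. 0 < d \<Longrightarrow> d \<le> d1 \<Longrightarrow> d powr m * K powr (1 - m) \<le> e"
    "\<And>d. 0 < d \<Longrightarrow> d \<le> d2 \<Longrightarrow> d powr (1 - m) * K powr m \<le> e"
    using small[of m "K powr (1 - m)"] small[of "1 - m" "K powr m"] m01 K by auto
  define d where "d = min e (min d1 d2)"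
  have d: "0 < d" "d \<le> e" "d powr m * K powr (1 - m) \<le> e" "K powr m * d powr (1 - m) \<le> e"
    using d12(1,2) d12(3,4)[of d] e by (auto simp: d_def mult.commute[of "K powr m"])
  \<comment> \<open>With one factor on the right equal to the ceiling \<open>N\<close> and the other
    at least \<open>e\<close>, the right side is at least \<open>K\<close>; the left side never
    exceeds K^m K^(1-m) = K.\<close>
  obtain N1 N2 where N12: "\<And>N. N \<ge> N1 \<Longrightarrow> K \<le> N powr r * e powr (1 - r)"
    "\<And>N. N \<ge> N2 \<Longrightarrow> K \<le> N powr (1 - r) * e powr r"
    using large[of r "e powr (1 - r)"] large[of "1 - r" "e powr r"] r e by auto
  define N where "N = max 1 (max N1 N2)"
  have N: "1 \<le> N" "K \<le> N powr r * e powr (1 - r)" "K \<le> e powr r * N powr (1 - r)"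
    using N12[of N] by (auto simp: N_def mult.commute)
  \<comment> \<open>The constants \<open>d\<close> and \<open>N\<close> are chosen such that, whenever one of the cut-offs is active, the
    hypothesis holds for the size of the bounds alone.\<close>
  define lo where "lo g x = (if x \<in> Z then d else max d (min (g x) K))" for g :: "real^'n \<Rightarrow> real" and x
  define hi where "hi g x = (if x \<in> Z then N else min (max (g x) e) N)" for g :: "real^'n \<Rightarrow> real" and x
  have lo_m[measurable]: "lo g \<in> borel_measurable borel" if "g \<in> borel_measurable borel" for g
    using that unfolding lo_def by measurable
  have hi_m[measurable]: "hi g \<in> borel_measurable borel" if "g \<in> borel_measurable borel" for g
    using that unfolding hi_def by measurable
  have lo_b: "lo g x \<in> {d..K}" and hi_b: "hi g x \<in> {e..N}" for g x
    using d e K N by (auto simp: lo_def hi_def)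
  have QO: "Q \<subseteq> pos_orthant"
  proof
    fix x assume "x \<in> Q"
    then have "1 / K \<le> x $ i" for i by (auto simp: Q_def)
    moreover have "0 < 1 / K" using K by simp
    ultimately show "x \<in> pos_orthant"
      unfolding pos_orthant_def mem_Collect_eq by (metis less_le_trans)
  qed
  have K1: "0 < 1 / K" "1 / K < K" using K less_1_mult[of K K] by (simp_all add: divide_less_eq)
  have vQ: "vpowmean \<gamma> \<sigma> x y \<in> Q" if "x \<in> Q" "y \<in> Q" "0 \<le> \<gamma>" "0 < \<sigma>" "\<sigma> < 1" for \<gamma> \<sigma> x y
    using that powmean_Icc[OF K1(1), of "x $ _" K "y $ _" \<gamma> \<sigma>] unfolding Q_def vpowmean_def by simp
  have main: "(LBINT x:Q. lo g1 x) powr m * (LBINT x:Q. lo g2 x) powr (1 - m)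
      \<le> (LBINT x:Q. hi g3 x) powr r * (LBINT x:Q. hi g4 x) powr (1 - r)"
    unfolding Q_def
  proof (rule four_function_inequality_box[OF K1(2) r s t m
      geo_expanding_powmean[OF K1(1) \<alpha> s] geo_expanding_powmean[OF K1(1) \<beta> t], where c = "min d e" and C = "max K N"])
    show "0 < min d e" using d e by simp
    show "lo g1 x \<in> {min d e..max K N}" "lo g2 x \<in> {min d e..max K N}"
      "hi g3 x \<in> {min d e..max K N}" "hi g4 x \<in> {min d e..max K N}" for x
      using lo_b[of g1 x] lo_b[of g2 x] hi_b[of g3 x] hi_b[of g4 x] by (auto simp: le_max_iff_disj min_le_iff_disj)
    fix x y :: "real^'n" assume "\<And>i. x $ i \<in> {1/K..K}" "\<And>i. y $ i \<in> {1/K..K}"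
    then have xy: "x \<in> Q" "y \<in> Q" by (auto simp: Q_def)
    define z3 z4 where "z3 = vpowmean \<alpha> s x y" and "z4 = vpowmean \<beta> t x y"
    have zQ: "z3 \<in> Q" "z4 \<in> Q"
      unfolding z3_def z4_def using vQ xy \<alpha> \<beta> s t by auto
    define L R where "L = lo g1 x powr m * lo g2 y powr (1 - m)"
      and "R = hi g3 z3 powr r * hi g4 z4 powr (1 - r)"
    have b: "d \<le> lo g1 x" "lo g1 x \<le> K" "d \<le> lo g2 y" "lo g2 y \<le> K"
      "e \<le> hi g3 z3" "e \<le> hi g4 z4"
      using lo_b hi_b by auto
    have "e powr r * e powr (1 - r) \<le> R"
      unfolding R_def using b e r by (intro mult_mono powr_mono2) auto
    then have Re: "e \<le> R" using e by (simp add: powr_add[symmetric])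
    have "L \<le> K powr m * K powr (1 - m)"
      unfolding L_def using b d m01 by (intro mult_mono powr_mono2) auto
    then have LK: "L \<le> K" using K by (simp add: powr_add[symmetric])
    consider "lo g1 x = d" | "lo g2 y = d" | "hi g3 z3 = N" | "hi g4 z4 = N"
      | "lo g1 x \<noteq> d" "lo g2 y \<noteq> d" "hi g3 z3 \<noteq> N" "hi g4 z4 \<noteq> N" by blast
    then have "L \<le> R"
    proof cases
      case 1
      then have "L \<le> d powr m * K powr (1 - m)"
        unfolding L_def using b d m01 by (intro mult_mono powr_mono2) auto
      then show ?thesis using d Re by linarith
    next
      case 2
      then have "L \<le> K powr m * d powr (1 - m)"
        unfolding L_def using b d m01 by (intro mult_mono powr_mono2) auto
      then show ?thesis using d Re by linarith
    next
      case 3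
      then have "N powr r * e powr (1 - r) \<le> R"
        unfolding R_def using b e r by (intro mult_mono powr_mono2) auto
      then show ?thesis using N LK by linarith
    next
      case 4
      then have "e powr r * N powr (1 - r) \<le> R"
        unfolding R_def using b e r by (intro mult_mono powr_mono2) auto
      then show ?thesis using N LK by linarith
    next
      \<comment> \<open>On \<open>Z\<close> the functions equal \<open>d\<close> or \<open>N\<close>
        by definition, so here all four points avoid \<open>Z\<close>. Thus \<open>le\<close>
        applies, and the remaining cut-offs only lower the left side and raise the right.\<close>
      case 5
      then have notZ: "x \<notin> Z" "y \<notin> Z" "z3 \<notin> Z" "z4 \<notin> Z"
        by (auto simp: lo_def hi_def split: if_splits)
      have "lo g1 x \<le> g1 x" "lo g2 y \<le> g2 y" "g3 z3 \<le> hi g3 z3" "g4 z4 \<le> hi g4 z4"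
        using 5 notZ by (auto simp: lo_def hi_def)
      then have "L \<le> g1 x powr m * g2 y powr (1 - m)" "g3 z3 powr r * g4 z4 powr (1 - r) \<le> R"
        unfolding L_def R_def using b d m01 r nn notZ by (auto intro!: mult_mono powr_mono2)
      moreover have "g1 x powr m * g2 y powr (1 - m) \<le> g3 z3 powr r * g4 z4 powr (1 - r)"
        unfolding z3_def z4_def by (rule le) (use xy zQ QO notZ in \<open>auto simp: z3_def z4_def\<close>)
      ultimately show ?thesis by linarith
    qed
    then show "lo g1 x powr m * lo g2 y powr (1 - m)
        \<le> hi g3 (\<chi> i. powmean \<alpha> s (x $ i) (y $ i)) powr r * hi g4 (\<chi> i. powmean \<beta> t (x $ i) (y $ i)) powr (1 - r)"
      by (simp add: L_def R_def z3_def z4_def vpowmean_def)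
  qed auto
  have Qbox: "Q = cbox (\<chi> i. 1 / K) (\<chi> i. K)"
    by (auto simp: Q_def mem_box_cart)
  then have Qm[measurable]: "Q \<in> sets borel" by simp
  have Qfin: "emeasure lborel Q < \<infinity>"
    unfolding Qbox by (rule emeasure_lborel_cbox_finite)
  have const: "set_integrable lborel Q (\<lambda>_. C)" for C :: real
    using Qfin by (simp add: set_integrable_def)
  have bounded: "set_integrable lborel Q h" if "h \<in> borel_measurable borel" "\<And>x. h x \<in> {0..C}" for h :: "real^'n \<Rightarrow> real" and C
    by (rule set_integrable_bound[OF const[of C]])
       (use that in \<open>auto simp: set_borel_measurable_def intro!: AE_I2 intro: order_trans[OF _ abs_ge_self]\<close>)
  have aeZ: "AE x in lborel. x \<notin> Z" by (rule AE_not_in[OF Z])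
  have lower: "0 \<le> (LBINT x:Q. min (g x) K)" "(LBINT x:Q. min (g x) K) \<le> (LBINT x:Q. lo g x)"
    if g: "integrable lborel g" and g0: "\<And>x. x \<notin> Z \<Longrightarrow> 0 \<le> g x" for g
  proof -
    have [measurable]: "g \<in> borel_measurable borel" using g by auto
    show "0 \<le> (LBINT x:Q. min (g x) K)"
      unfolding set_lebesgue_integral_def
      using aeZ K g0 by (intro integral_nonneg_AE) (auto elim!: eventually_mono)
    have "set_integrable lborel Q (lo g)"
      using lo_b[of g] d by (intro bounded[where C = K]) (auto intro: order_trans[OF less_imp_le])
    moreover have "AE x in lborel. min (g x) K \<le> lo g x"
      using aeZ by eventually_elim (auto simp: lo_def)
    moreover have "set_integrable lborel Q (\<lambda>x. min (g x) K)"
    proof (rule set_integrable_bound[OF const[of K]])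
      show "AE x in lborel. x \<in> Q \<longrightarrow> norm (min (g x) K) \<le> norm K"
        using aeZ by eventually_elim (use K g0 in auto)
    qed (simp add: set_borel_measurable_def)
    ultimately show "(LBINT x:Q. min (g x) K) \<le> (LBINT x:Q. lo g x)"
      by (intro set_integral_mono_AE) (auto elim!: eventually_mono)
  qed
  have upper: "0 \<le> (LBINT x:Q. hi g x)" "(LBINT x:Q. hi g x) \<le> integral\<^sup>L lborel g + e * measure lborel Q"
    if g: "integrable lborel g" and g0: "\<And>x. x \<notin> Z \<Longrightarrow> 0 \<le> g x" for g
  proof -
    have [measurable]: "g \<in> borel_measurable borel" using g by auto
    have hi0: "0 \<le> hi g x" for x using hi_b[of g x] e by auto
    show "0 \<le> (LBINT x:Q. hi g x)"
      unfolding set_lebesgue_integral_def using hi0 by (intro integral_nonneg_AE) auto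
    have "set_integrable lborel Q (hi g)"
      using hi_b[of g] hi0 by (intro bounded[where C = N]) auto
    moreover have intQ: "set_integrable lborel Q g"
      unfolding set_integrable_def using g by (intro integrable_mult_indicator) auto
    \<comment> \<open>For g \<ge> 0 the floor adds at most \<open>e\<close>; over the box this gives
      the error term \<open>e * measure lborel Q\<close>.\<close>
    moreover have "AE x in lborel. hi g x \<le> g x + e"
      using aeZ
    proof eventually_elim
      case (elim x)
      then show ?case using g0[OF elim] e by (simp add: hi_def min_le_iff_disj)
    qed
    ultimately have "(LBINT x:Q. hi g x) \<le> (LBINT x:Q. g x + e)"
      using const[of e] by (intro set_integral_mono_AE set_integral_add(1)) (auto elim!: eventually_mono)
    also have "\<dots> = (LBINT x:Q. g x) + e * measure lborel Q"
      using intQ const[of e] Qfin by (simp add: set_integral_add(2) set_integral_const)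
    also have "(LBINT x:Q. g x) \<le> integral\<^sup>L lborel g"
      unfolding set_lebesgue_integral_def
    proof (rule integral_mono_AE)
      show "AE x in lborel. indicator Q x *\<^sub>R g x \<le> g x"
        using aeZ by eventually_elim (use g0 in \<open>auto simp: indicator_def\<close>)
    qed (use intQ g in \<open>auto simp: set_integrable_def\<close>)
    finally show "(LBINT x:Q. hi g x) \<le> integral\<^sup>L lborel g + e * measure lborel Q" by simp
  qed
  note L1 = lower[OF int(1) nn(1)] and L2 = lower[OF int(2) nn(2)]
  note U3 = upper[OF int(3) nn(3)] and U4 = upper[OF int(4) nn(4)]
  have "(LBINT x:Q. min (g1 x) K) powr m * (LBINT x:Q. min (g2 x) K) powr (1 - m)
      \<le> (LBINT x:Q. lo g1 x) powr m * (LBINT x:Q. lo g2 x) powr (1 - m)"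
    using L1 L2 m01 by (intro mult_mono powr_mono2) auto
  also note main
  also have "(LBINT x:Q. hi g3 x) powr r * (LBINT x:Q. hi g4 x) powr (1 - r)
      \<le> (integral\<^sup>L lborel g3 + e * measure lborel Q) powr r * (integral\<^sup>L lborel g4 + e * measure lborel Q) powr (1 - r)"
    using U3 U4 r by (intro mult_mono powr_mono2) auto
  finally show ?thesis .
qed

text \<open>Dominated convergence with \<open>g\<close> itself as majorant: every point of the open
  orthant eventually stays in the growing boxes. The shift by 2 keeps the parameter above 1, as the
  truncated inequality demands.\<close>

lemma integral_truncation_tendsto:
  fixes g :: "real^'n \<Rightarrow> real"
  assumes g: "integrable lborel g" and g0: "AE x in lborel. 0 \<le> g x" "AE x in lborel. x \<notin> pos_orthant \<longrightarrow> g x = 0"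
  shows "(\<lambda>n. LBINT x:{x. \<forall>i. x $ i \<in> {1 / real (n + 2)..real (n + 2)}}. min (g x) (real (n + 2)))
     \<longlonglongrightarrow> integral\<^sup>L lborel g"
  unfolding set_lebesgue_integral_def
proof (rule integral_dominated_convergence[where w = g])
  let ?Q = "\<lambda>n. {x :: real^'n. \<forall>i. x $ i \<in> {1 / real (n + 2)..real (n + 2)}}"
  have [measurable]: "g \<in> borel_measurable borel" using g by auto
  have "?Q n = cbox (\<chi> i. 1 / real (n + 2)) (\<chi> i. real (n + 2))" for n
    by (auto simp: mem_box_cart)
  then have [measurable]: "?Q n \<in> sets borel" for n by simp
  show "(\<lambda>x. indicator (?Q n) x *\<^sub>R min (g x) (real (n + 2))) \<in> borel_measurable lborel" for n
    by measurable
  show "AE x in lborel. norm (indicator (?Q n) x *\<^sub>R min (g x) (real (n + 2))) \<le> g x" for n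
    using g0(1) by eventually_elim (auto simp: indicator_def)
  show "AE x in lborel. (\<lambda>n. indicator (?Q n) x *\<^sub>R min (g x) (real (n + 2))) \<longlonglongrightarrow> g x"
    using g0
  proof eventually_elim
    case (elim x)
    show ?case
    proof (cases "x \<in> pos_orthant")
      case True
      have ev: "eventually (\<lambda>n. c \<le> real (n + 2)) sequentially" for c
      proof -
        obtain n0 where "c \<le> real n0" using real_arch_simple by blast
        then show ?thesis by (intro eventually_sequentiallyI[of n0]) auto
      qed
      have "eventually (\<lambda>n. x $ i \<in> {1 / real (n + 2)..real (n + 2)}) sequentially" for i
        using ev[of "x $ i"] ev[of "1 / x $ i"]
      proof eventually_elim
        case (elim n)
        have "0 < x $ i" using True by (simp add: pos_orthant_def)
        then show ?case using elim by (auto simp: divide_le_eq mult.commute)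
      qed
      then have "eventually (\<lambda>n. \<forall>i. x $ i \<in> {1 / real (n + 2)..real (n + 2)}) sequentially"
        by (intro eventually_all_finite)
      then have "eventually (\<lambda>n. indicator (?Q n) x *\<^sub>R min (g x) (real (n + 2)) = g x) sequentially"
        using ev[of "g x"] by eventually_elim (simp add: indicator_def)
      then show ?thesis by (rule tendsto_eventually)
    next
      case False
      then have "indicator (?Q n) x *\<^sub>R min (g x) (real (n + 2)) = 0" for n
        using elim by simp
      then show ?thesis using elim False by simp
    qed
  qed
qed (use g in auto)

theorem theorem6p3:
  fixes r s t \<alpha> \<beta> m :: real
    and f1 f2 f3 f4 :: "real^'n \<Rightarrow> real"
  assumes "0 < r" "r < 1" "0 < s" "s < 1" "0 < t" "t < 1"
    and "m = s * r + (1 - r) * t"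
    and "0 \<le> \<alpha>" "\<alpha> \<le> 1" "0 \<le> \<beta>" "\<beta> \<le> 1"
    and "\<And>x. x \<in> pos_orthant \<Longrightarrow> 0 < f1 x"
    and "\<And>x. x \<in> pos_orthant \<Longrightarrow> 0 < f2 x"
    and "\<And>x. x \<in> pos_orthant \<Longrightarrow> 0 < f3 x"
    and "\<And>x. x \<in> pos_orthant \<Longrightarrow> 0 < f4 x"
    and "f1 integrable_on pos_orthant" "f2 integrable_on pos_orthant"
    and "f3 integrable_on pos_orthant" "f4 integrable_on pos_orthant"
    and "\<And>x y. x \<in> pos_orthant \<Longrightarrow> y \<in> pos_orthant \<Longrightarrow>
           f1 x powr m * f2 y powr (1 - m)
             \<le> f3 (vpowmean \<alpha> s x y) powr r * f4 (vpowmean \<beta> t x y) powr (1 - r)"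
  shows "integral pos_orthant f1 powr m * integral pos_orthant f2 powr (1 - m)
           \<le> integral pos_orthant f3 powr r * integral pos_orthant f4 powr (1 - r)"
proof -
  have O: "(pos_orthant :: (real^'n) set) \<in> sets borel"
  proof -
    have "(pos_orthant :: (real^'n) set) = (\<Inter>i. {x. 0 < x $ i})"
      by (auto simp: pos_orthant_def)
    also have "open \<dots>"
      by (intro open_INT ballI open_Collect_less continuous_intros) auto
    finally show ?thesis by simp
  qed
  note pos = assms(12-15)
  note nn = pos[THEN less_imp_le]
  obtain g1 Z1 where g1: "integrable lborel g1" "integral\<^sup>L lborel g1 = integral pos_orthant f1" "Z1 \<in> null_sets lborel"
    "\<And>x. x \<notin> Z1 \<Longrightarrow> g1 x = indicator pos_orthant x * f1 x"
    using integrable_on_Borel_representative[OF O assms(16) nn(1)] by blast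
  obtain g2 Z2 where g2: "integrable lborel g2" "integral\<^sup>L lborel g2 = integral pos_orthant f2" "Z2 \<in> null_sets lborel"
    "\<And>x. x \<notin> Z2 \<Longrightarrow> g2 x = indicator pos_orthant x * f2 x"
    using integrable_on_Borel_representative[OF O assms(17) nn(2)] by blast
  obtain g3 Z3 where g3: "integrable lborel g3" "integral\<^sup>L lborel g3 = integral pos_orthant f3" "Z3 \<in> null_sets lborel"
    "\<And>x. x \<notin> Z3 \<Longrightarrow> g3 x = indicator pos_orthant x * f3 x"
    using integrable_on_Borel_representative[OF O assms(18) nn(3)] by blast
  obtain g4 Z4 where g4: "integrable lborel g4" "integral\<^sup>L lborel g4 = integral pos_orthant f4" "Z4 \<in> null_sets lborel"
    "\<And>x. x \<notin> Z4 \<Longrightarrow> g4 x = indicator pos_orthant x * f4 x"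
    using integrable_on_Borel_representative[OF O assms(19) nn(4)] by blast
  define Z where "Z = Z1 \<union> Z2 \<union> Z3 \<union> Z4"
  have Z: "Z \<in> null_sets lborel" using g1(3) g2(3) g3(3) g4(3) by (auto simp: Z_def)
  have gZ: "g1 x = indicator pos_orthant x * f1 x" "g2 x = indicator pos_orthant x * f2 x"
    "g3 x = indicator pos_orthant x * f3 x" "g4 x = indicator pos_orthant x * f4 x" if "x \<notin> Z" for x
    using that g1(4) g2(4) g3(4) g4(4) by (auto simp: Z_def)
  have g0: "0 \<le> g1 x" "0 \<le> g2 x" "0 \<le> g3 x" "0 \<le> g4 x" if "x \<notin> Z" for x
    using gZ[OF that] nn[of x] by (auto simp: indicator_def)
  have ae: "AE x in lborel. x \<notin> Z" by (rule AE_not_in[OF Z])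
  have int0: "0 \<le> integral\<^sup>L lborel g3" "0 \<le> integral\<^sup>L lborel g4"
    using ae g0 by (auto intro!: integral_nonneg_AE elim!: eventually_mono)
  let ?Q = "\<lambda>K. {x :: real^'n. \<forall>i. x $ i \<in> {1 / K..K}}"
  \<comment> \<open>The order of limits matters: the error is \<open>e\<close> times the volume of
    the box, so \<open>e\<close> tends to 0 while \<open>K\<close> is fixed, and only then does
    \<open>K\<close> grow.\<close>
  have bound: "(LBINT x:?Q K. min (g1 x) K) powr m * (LBINT x:?Q K. min (g2 x) K) powr (1 - m)
      \<le> integral\<^sup>L lborel g3 powr r * integral\<^sup>L lborel g4 powr (1 - r)" if K: "1 < K" for K
  proof (rule tendsto_lowerbound)
    let ?V = "measure lborel (?Q K)"
    have "((\<lambda>e. integral\<^sup>L lborel g + e * ?V) \<longlongrightarrow> integral\<^sup>L lborel g + 0 * ?V) (at_right 0)" for g :: "real^'n \<Rightarrow> real"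
      by (intro tendsto_intros)
    \<comment> \<open>The integrals are known here only to be nonnegative;
      \<open>tendsto_powr'\<close> admits a limit base of 0 for a positive exponent once the bases
      are eventually nonnegative.\<close>
    moreover have "eventually (\<lambda>e. 0 \<le> integral\<^sup>L lborel g + e * ?V) (at_right 0)" if "0 \<le> integral\<^sup>L lborel g" for g :: "real^'n \<Rightarrow> real"
      using that by (auto simp: eventually_at_filter)
    ultimately show "((\<lambda>e. (integral\<^sup>L lborel g3 + e * ?V) powr r * (integral\<^sup>L lborel g4 + e * ?V) powr (1 - r))
        \<longlongrightarrow> integral\<^sup>L lborel g3 powr r * integral\<^sup>L lborel g4 powr (1 - r)) (at_right 0)"
      using int0 assms(1,2) by (intro tendsto_mult tendsto_powr' tendsto_const) auto
    have "eventually (\<lambda>e::real. e \<in> {0<..<1}) (at_right 0)"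
      by (rule eventually_at_right_real) simp
    then show "eventually (\<lambda>e. (LBINT x:?Q K. min (g1 x) K) powr m * (LBINT x:?Q K. min (g2 x) K) powr (1 - m)
       \<le> (integral\<^sup>L lborel g3 + e * ?V) powr r * (integral\<^sup>L lborel g4 + e * ?V) powr (1 - r)) (at_right 0)"
    proof eventually_elim
      case (elim e)
      then have "0 < e" "e \<le> 1" by auto
      from K this assms(1-11) g1(1) g2(1) g3(1) g4(1) Z g0
      show ?case
      proof (rule four_function_inequality_truncated)
        fix x y
        assume "x \<in> pos_orthant - Z" "y \<in> pos_orthant - Z"
          "vpowmean \<alpha> s x y \<in> pos_orthant - Z" "vpowmean \<beta> t x y \<in> pos_orthant - Z"
        then show "g1 x powr m * g2 y powr (1 - m)
          \<le> g3 (vpowmean \<alpha> s x y) powr r * g4 (vpowmean \<beta> t x y) powr (1 - r)"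
          using assms(20)[of x y] by (simp add: gZ)
      qed
    qed
  qed simp
  have lim: "(\<lambda>n. LBINT x:?Q (real (n + 2)). min (g x) (real (n + 2))) \<longlonglongrightarrow> integral\<^sup>L lborel g"
    "eventually (\<lambda>n. 0 \<le> (LBINT x:?Q (real (n + 2)). min (g x) (real (n + 2)))) sequentially"
    if "integrable lborel g" "\<And>x. x \<notin> Z \<Longrightarrow> 0 \<le> g x" "\<And>x. x \<notin> Z \<Longrightarrow> g x = indicator pos_orthant x * f x" for g f
  proof -
    show "(\<lambda>n. LBINT x:?Q (real (n + 2)). min (g x) (real (n + 2))) \<longlonglongrightarrow> integral\<^sup>L lborel g"
    proof (rule integral_truncation_tendsto[OF that(1)])
      show "AE x in lborel. 0 \<le> g x" using ae by eventually_elim (rule that(2))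
      show "AE x in lborel. x \<notin> pos_orthant \<longrightarrow> g x = 0"
        using ae by eventually_elim (simp add: that(3))
    qed
    show "eventually (\<lambda>n. 0 \<le> (LBINT x:?Q (real (n + 2)). min (g x) (real (n + 2)))) sequentially"
      unfolding set_lebesgue_integral_def
    proof (rule always_eventually, rule allI, rule integral_nonneg_AE)
      show "AE x in lborel. 0 \<le> indicator (?Q (real (n + 2))) x *\<^sub>R min (g x) (real (n + 2))" for n
        using ae by eventually_elim (simp add: that(2))
    qed
  qed
  have m01: "0 < m" "m < 1"
    using convex_combination_unit_interval[OF assms(1-6)] by (auto simp: assms(7))
  have "integral\<^sup>L lborel g1 powr m * integral\<^sup>L lborel g2 powr (1 - m)
      \<le> integral\<^sup>L lborel g3 powr r * integral\<^sup>L lborel g4 powr (1 - r)"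
  proof (rule tendsto_upperbound)
    show "(\<lambda>n. (LBINT x:?Q (real (n + 2)). min (g1 x) (real (n + 2))) powr m
         * (LBINT x:?Q (real (n + 2)). min (g2 x) (real (n + 2))) powr (1 - m))
       \<longlonglongrightarrow> integral\<^sup>L lborel g1 powr m * integral\<^sup>L lborel g2 powr (1 - m)"
      using lim[OF g1(1) g0(1) gZ(1)] lim[OF g2(1) g0(2) gZ(2)] m01
      by (intro tendsto_mult tendsto_powr' tendsto_const) auto
    show "eventually (\<lambda>n. (LBINT x:?Q (real (n + 2)). min (g1 x) (real (n + 2))) powr m
         * (LBINT x:?Q (real (n + 2)). min (g2 x) (real (n + 2))) powr (1 - m)
       \<le> integral\<^sup>L lborel g3 powr r * integral\<^sup>L lborel g4 powr (1 - r)) sequentially"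
      by (intro always_eventually allI bound) simp
  qed simp
  then show ?thesis by (simp only: g1(2) g2(2) g3(2) g4(2))
qed

end
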